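(* Let $n\ge 3$ and let $V(u,r)$ be a smooth compactly supported radially symmetric potential on $\mathbb{R}\times\mathbb{R}^n$ (depending on $u$ and $r=|x|$) satisfying $V''_{uu}(u,r)\le \frac{1}{4r^2}$ for all $u$ and $r>0$. For $A\in\mathbb{R}$ let $N_A$ be the set of all radial solutions $u(r)$, $r>0$, of $$u''+\frac{n-1}{r}u'+V'_u(u,r)=0$$ which, for some $\alpha\in\mathbb{R}$, satisfy $u(r)=\frac{\alpha}{r^{n-2}}+A$ for all $r$ outside the support of $V$ (i.e. for all sufficiently large $r$). Then for each $A$, the set $N_A$ is totally ordered (for any two distinct elements $u_1,u_2\in N_A$, either $u_1(r)<u_2(r)$ for all $r>0$ or $u_1(r)>u_2(r)$ for all $r>0$), and the graphs $\{(u(|x|),x): x\in\mathbb{R}^n\setminus\{0\}\}$ of the solutions in $N_A$ form a smooth foliation of $\mathbb{R}^{n+1}\setminus(\mathbb{R}\times\{0\})$, where $\mathbb{R}^{n+1}=\mathbb{R}(u)\times\mathbb{R}^n(x)$.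
   Context: The radial ODE is the equation satisfied by radially symmetric solutions $u(|x|)$ of $\Delta u=-V'_u(u,x)$. *)

theory Defs
  imports "HOL-Analysis.Analysis"
begin

fun pderivs :: "'a::real_normed_vector list \<Rightarrow> ('a \<Rightarrow> 'b::real_normed_vector) \<Rightarrow> 'a \<Rightarrow> 'b" where
  "pderivs [] f = f"
| "pderivs (v # vs) f = (\<lambda>x. frechet_derivative (pderivs vs f) (at x) v)"

text \<open>C-infinity smoothness on an open set: all iterated partial derivatives
  (along basis directions) exist and are (Frechet) differentiable, hence continuous.\<close>
definition smooth_on :: "'a::euclidean_space set \<Rightarrow> ('a \<Rightarrow> 'b::euclidean_space) \<Rightarrow> bool" where
  "smooth_on S f \<longleftrightarrow> open S \<and>
     (\<forall>vs. set vs \<subseteq> Basis \<longrightarrow> (\<forall>x\<in>S. pderivs vs f differentiable (at x)))"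

text \<open>A smooth codimension-one foliation of an open set M of a Euclidean space
  by the family of leaves \<L>: the leaves are nonempty, pairwise disjoint and cover M,
  and every point has a smooth foliation chart (a diffeomorphism onto a convex open set)
  in which the intersection of each leaf with the chart domain is a union of
  hyperplane slices (plaques).\<close>
definition smooth_foliation :: "'a::euclidean_space set \<Rightarrow> 'a set set \<Rightarrow> bool" where
  "smooth_foliation M \<L> \<longleftrightarrow>
     open M \<and> (\<forall>L\<in>\<L>. L \<noteq> {} \<and> L \<subseteq> M) \<and> \<Union>\<L> = M \<and> disjoint \<L> \<and>
     (\<forall>p\<in>M. \<exists>U W (\<phi>::'a \<Rightarrow> 'a) \<psi> b.
        open U \<and> p \<in> U \<and> U \<subseteq> M \<and> open W \<and> convex W \<and> \<phi> ` U = W \<and>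
        (\<forall>x\<in>U. \<psi> (\<phi> x) = x) \<and> (\<forall>y\<in>W. \<phi> (\<psi> y) = y) \<and>
        smooth_on U \<phi> \<and> smooth_on W \<psi> \<and> b \<in> Basis \<and>
        (\<forall>L\<in>\<L>. \<forall>y\<in>\<phi> ` (L \<inter> U). \<forall>y'\<in>W. y' \<bullet> b = y \<bullet> b \<longrightarrow> y' \<in> \<phi> ` (L \<inter> U)))"

definition radial_solution :: "nat \<Rightarrow> (real \<Rightarrow> real \<Rightarrow> real) \<Rightarrow> (real \<Rightarrow> real) \<Rightarrow> bool" where
  "radial_solution n V u \<longleftrightarrow> (\<exists>u1 u2. \<forall>r>0.
      (u has_real_derivative u1 r) (at r) \<and> (u1 has_real_derivative u2 r) (at r) \<and>
      u2 r + (real n - 1) / r * u1 r + deriv (\<lambda>w. V w r) (u r) = 0)"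

definition N_set :: "nat \<Rightarrow> (real \<Rightarrow> real \<Rightarrow> real) \<Rightarrow> real \<Rightarrow> (real \<Rightarrow> real) set" where
  "N_set n V A = {u. radial_solution n V u \<and>
      (\<exists>\<alpha>. \<forall>\<^sub>F r in at_top. u r = \<alpha> / r ^ (n - 2) + A)}"

definition radial_graph :: "(real \<Rightarrow> real) \<Rightarrow> (real \<times> (real ^ 'n)) set" where
  "radial_graph u = {(u (norm x), x) | x. x \<noteq> 0}"

end

theory Submission
  imports Defs
begin

text \<open>
  Put \<open>c = (n - 2) / 2\<close>, \<open>r = R exp (- s)\<close> and \<open>u = A + exp (c s) v\<close>, where \<open>V\<close> vanishes for
  \<open>r \<ge> R\<close>. The radial equation becomes \<open>v'' = G v s\<close>, and \<open>V\<^sub>u\<^sub>u \<le> 1 / (4 r\<^sup>2)\<close> together with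
  \<open>c \<ge> 1 / 2\<close> makes \<open>G\<close> nondecreasing in \<open>v\<close>. For \<open>s \<le> 0\<close> the solutions in \<open>N\<^sub>A\<close>
  are \<open>\<beta> exp (c s)\<close>, so they form a family \<open>v \<beta>\<close> with \<open>v = \<beta>\<close> and \<open>v' = c \<beta>\<close> at \<open>s = 0\<close>. The difference
  of two of them is convex as long as it is nonnegative and starts with nonnegative slope, hence it never
  falls below its initial value. So \<open>v \<beta> s\<close> is increasing in \<open>\<beta>\<close>, with slope bounded below locally
  uniformly: the solutions are ordered, exactly one passes through each point, and since
  \<open>v \<beta> s\<close> depends smoothly on \<open>(\<beta>, s)\<close>, the parameter \<open>\<beta>\<close> is a smooth function of the point,
  which straightens the leaves.
\<close>

section \<open>Functions of class \<open>C\<^sup>k\<close>\<close>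

text \<open>The exponent c = (n - 2) / 2 is the one for which the first-order term cancels, and c^2
  is the constant coefficient that remains. Where V vanishes, v'' = c^2 v has the modes exp (c s)
  and exp (- c s). The second, multiplied by exp (c s), only adds a constant to u, so prescribing A
  excludes it; the first gives \<alpha> / r^(n - 2). Hence exactly one free parameter is left. Two
  demands shape the rest. The family must exist for all s, that is for r arbitrarily close to 0:
  compact support bounds V_uu, so G is globally Lipschitz in v, locally uniformly in s, and no
  solution blows up. The charts must be smooth to all orders: continuous dependence is only the
  start, and each further order in \<beta> comes from a linearized equation. The ordering is proved
  with a quantitative gap because strict inequality alone shows neither that every point is reached
  nor that the derivative in \<beta> is nonzero.\<close>

fun Ck_on :: "nat \<Rightarrow> 'a::euclidean_space set \<Rightarrow> ('a \<Rightarrow> 'b::euclidean_space) \<Rightarrow> bool" where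
  "Ck_on 0 S f \<longleftrightarrow> continuous_on S f"
| "Ck_on (Suc k) S f \<longleftrightarrow> (\<forall>x\<in>S. f differentiable (at x)) \<and>
     (\<forall>b\<in>Basis. Ck_on k S (\<lambda>x. frechet_derivative f (at x) b))"

text \<open>\<open>frechet_derivative\<close> is a choice among all derivatives at the point.
  Functions equal on an open set have the same candidates, so the choices coincide even where no
  derivative exists.\<close>

lemma frechet_derivative_cong_open:
  assumes "open S" "x \<in> S" "\<And>x. x \<in> S \<Longrightarrow> f x = g x"
  shows "frechet_derivative f (at x) = frechet_derivative g (at x)"
proof -
  have "(f has_derivative D) (at x) \<longleftrightarrow> (g has_derivative D) (at x)" for D
    using has_derivative_transform_within_open[OF _ assms(1,2), of f D UNIV g]
      has_derivative_transform_within_open[OF _ assms(1,2), of g D UNIV f] assms(3) by auto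
  then show ?thesis by (simp add: frechet_derivative_def)
qed

lemma differentiable_cong_open:
  assumes "open S" "x \<in> S" "\<And>x. x \<in> S \<Longrightarrow> f x = g x"
  shows "f differentiable (at x) \<longleftrightarrow> g differentiable (at x)"
  using has_derivative_transform_within_open[OF _ assms(1,2), of f _ UNIV g]
    has_derivative_transform_within_open[OF _ assms(1,2), of g _ UNIV f] assms(3)
  unfolding differentiable_def by auto

lemma Ck_on_cong:
  assumes "open S" "\<And>x. x \<in> S \<Longrightarrow> f x = g x"
  shows "Ck_on k S f \<longleftrightarrow> Ck_on k S g"
  using assms(2)
proof (induction k arbitrary: f g)
  case 0
  then show ?case by (simp cong: continuous_on_cong)
next
  case (Suc k)
  have "Ck_on k S (\<lambda>x. frechet_derivative f (at x) b) \<longleftrightarrow> Ck_on k S (\<lambda>x. frechet_derivative g (at x) b)" for b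
    by (rule Suc.IH) (simp add: frechet_derivative_cong_open[OF assms(1) _ Suc.prems])
  then show ?case
    using differentiable_cong_open[OF assms(1) _ Suc.prems] by simp
qed

text \<open>Admits an explicit derivative formula in place of the chosen
  \<open>frechet_derivative\<close>; the two agree by uniqueness, and openness of \<open>S\<close>
  carries the agreement through the further derivatives.\<close>

lemma Ck_on_SucI:
  assumes "open S" "\<And>x. x \<in> S \<Longrightarrow> (f has_derivative f' x) (at x)"
    "\<And>b. b \<in> Basis \<Longrightarrow> Ck_on k S (\<lambda>x. f' x b)"
  shows "Ck_on (Suc k) S f"
proof -
  have "Ck_on k S (\<lambda>x. frechet_derivative f (at x) b)" if "b \<in> Basis" for b
    using assms(3)[OF that] assms(2)
    by (subst Ck_on_cong[OF assms(1), where g = "\<lambda>x. f' x b"])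
      (auto dest!: frechet_derivative_at[OF assms(2)])
  then show ?thesis using assms(2) by (auto simp: differentiable_def)
qed

lemma Ck_on_Suc_imp_has_derivative:
  assumes "Ck_on (Suc k) S f" "x \<in> S"
  shows "(f has_derivative frechet_derivative f (at x)) (at x)"
  using assms frechet_derivative_works by auto

lemma Ck_on_Suc_imp_Ck_on: "Ck_on (Suc k) S f \<Longrightarrow> Ck_on k S f"
proof (induction k arbitrary: f)
  case 0
  then show ?case
    by (auto intro!: continuous_at_imp_continuous_on differentiable_imp_continuous_within)
qed (simp del: Ck_on.simps(1))

lemma Ck_on_imp_continuous_on: "Ck_on k S f \<Longrightarrow> continuous_on S f"
  by (induction k) (auto simp del: Ck_on.simps(2) dest: Ck_on_Suc_imp_Ck_on)

lemma Ck_on_subset: "Ck_on k S f \<Longrightarrow> T \<subseteq> S \<Longrightarrow> Ck_on k T f"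
  by (induction k arbitrary: f) (auto intro: continuous_on_subset)

lemma pderivs_append: "pderivs (vs @ ws) f = pderivs vs (pderivs ws f)"
  by (induction vs) auto

text \<open>\<open>smooth_on\<close> speaks of all lists of directions at once, whereas
  \<open>Ck_on\<close> counts the order and so permits induction; all regularity proofs run through
  the latter.\<close>

lemma smooth_on_iff_Ck_on: "smooth_on S f \<longleftrightarrow> open S \<and> (\<forall>k. Ck_on k S f)"
proof safe
  fix k assume "smooth_on S f"
  then show "Ck_on k S f"
  proof (induction k arbitrary: f)
    case 0
    then have "\<forall>x\<in>S. pderivs [] f differentiable (at x)" unfolding smooth_on_def by (metis empty_set empty_subsetI)
    then show ?case
      by (auto intro!: continuous_at_imp_continuous_on differentiable_imp_continuous_within)
  next
    case (Suc k)
    then have 1: "\<forall>x\<in>S. pderivs [] f differentiable (at x)" unfolding smooth_on_def by (metis empty_set empty_subsetI)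
    have "smooth_on S (pderivs [b] f)" if "b \<in> Basis" for b
      using Suc.prems that unfolding smooth_on_def pderivs_append[symmetric] by simp
    then show ?case using 1 Suc.IH by simp
  qed
next
  assume S: "open S" and "\<forall>k. Ck_on k S f"
  have "\<forall>x\<in>S. pderivs vs f differentiable (at x)" if "set vs \<subseteq> Basis" "\<forall>k. Ck_on k S f" for vs
    using that
  \<comment> \<open>\<open>pderivs\<close> differentiates along the last direction of the list
    first, and \<open>Ck_on\<close> peels off the derivative taken first, so the list is consumed
    from its end.\<close>
  proof (induction vs arbitrary: f rule: rev_induct)
    case Nil
    then have "Ck_on (Suc 0) S f" by blast
    then show ?case by simp
  next
    case (snoc v vs)
    have "\<forall>k. Ck_on k S (pderivs [v] f)"
    proof
      fix k
      have "Ck_on (Suc k) S f" using snoc.prems by blast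
      then show "Ck_on k S (pderivs [v] f)" using snoc.prems(1) by simp
    qed
    then show ?case using snoc by (simp add: pderivs_append)
  qed
  then show "smooth_on S f" using S \<open>\<forall>k. Ck_on k S f\<close> unfolding smooth_on_def by blast
qed (simp add: smooth_on_def)

section \<open>Closure of the classes C^k under algebraic operations and composition\<close>

lemma Ck_on_const: "open S \<Longrightarrow> Ck_on k S (\<lambda>x. c)"
proof (induction k arbitrary: c)
  case (Suc k)
  show ?case by (rule Ck_on_SucI[where f' = "\<lambda>x h. 0"]) (use Suc in auto)
qed simp

lemma Ck_on_bounded_linear:
  assumes "bounded_linear f" "open S"
  shows "Ck_on k S f"
proof (cases k)
  case 0
  then show ?thesis using assms by (simp add: linear_continuous_on)
next
  case (Suc l)
  show ?thesis unfolding Suc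
    by (rule Ck_on_SucI[where f' = "\<lambda>x. f"])
      (use assms in \<open>auto intro: bounded_linear_imp_has_derivative Ck_on_const\<close>)
qed

lemma Ck_on_add:
  assumes "open S" "Ck_on k S f" "Ck_on k S g"
  shows "Ck_on k S (\<lambda>x. f x + g x)"
  using assms(2,3)
proof (induction k arbitrary: f g)
  case 0
  then show ?case by (auto intro: continuous_intros)
next
  case (Suc k)
  show ?case
    by (rule Ck_on_SucI[OF assms(1), where f' = "\<lambda>x h. frechet_derivative f (at x) h + frechet_derivative g (at x) h"])
      (use Suc in \<open>auto intro!: has_derivative_add simp: frechet_derivative_works[symmetric]\<close>)
qed

lemma Ck_on_sum:
  assumes "open S" "\<And>i. i \<in> I \<Longrightarrow> Ck_on k S (f i)"
  shows "Ck_on k S (\<lambda>x. \<Sum>i\<in>I. f i x)"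
proof (cases "finite I")
  case True
  then show ?thesis using assms(2)
    by (induction I) (auto intro: Ck_on_const Ck_on_add assms(1))
qed (simp add: Ck_on_const assms(1))

text \<open>One Leibniz rule covers scalar multiples, inner products and real products. The
  derivative keeps undifferentiated factors, so the induction also uses that order
  \<open>Suc k\<close> implies order \<open>k\<close>.\<close>

lemma Ck_on_bilinear:
  assumes "bounded_bilinear prd" "open S" "Ck_on k S f" "Ck_on k S g"
  shows "Ck_on k S (\<lambda>x. prd (f x) (g x))"
  using assms(3,4)
proof (induction k arbitrary: f g)
  case 0
  then show ?case using bounded_bilinear.continuous_on[OF assms(1)] by auto
next
  case (Suc k)
  show ?case
    by (rule Ck_on_SucI[OF assms(2), where f' = "\<lambda>x h. prd (f x) (frechet_derivative g (at x) h) + prd (frechet_derivative f (at x) h) (g x)"])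
      (use Suc Ck_on_Suc_imp_Ck_on[OF Suc.prems(1)] Ck_on_Suc_imp_Ck_on[OF Suc.prems(2)] in
        \<open>auto intro!: bounded_bilinear.FDERIV[OF assms(1)] Ck_on_add assms(2) simp: frechet_derivative_works[symmetric]\<close>)
qed

lemmas Ck_on_scaleR = Ck_on_bilinear[OF bounded_bilinear_scaleR]
lemmas Ck_on_inner = Ck_on_bilinear[OF bounded_bilinear_inner]
lemmas Ck_on_mult = Ck_on_bilinear[OF bounded_bilinear_mult]

lemma Ck_on_Pair:
  assumes "open S" "Ck_on k S f" "Ck_on k S g"
  shows "Ck_on k S (\<lambda>x. (f x, g x))"
  using assms(2,3)
proof (induction k arbitrary: f g)
  case 0
  then show ?case by (auto intro: continuous_intros)
next
  case (Suc k)
  show ?case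
    by (rule Ck_on_SucI[OF assms(1), where f' = "\<lambda>x h. (frechet_derivative f (at x) h, frechet_derivative g (at x) h)"])
      (use Suc in \<open>auto intro!: has_derivative_Pair simp: frechet_derivative_works[symmetric]\<close>)
qed

lemma frechet_derivative_sum_Basis:
  assumes "f differentiable (at x)"
  shows "frechet_derivative f (at x) h = (\<Sum>b\<in>Basis. (h \<bullet> b) *\<^sub>R frechet_derivative f (at x) b)"
proof -
  have "linear (frechet_derivative f (at x))"
    using assms by (rule linear_frechet_derivative)
  then have "frechet_derivative f (at x) (\<Sum>b\<in>Basis. (h \<bullet> b) *\<^sub>R b) = (\<Sum>b\<in>Basis. (h \<bullet> b) *\<^sub>R frechet_derivative f (at x) b)"
    by (simp add: linear_sum linear_cmul)
  then show ?thesis by (simp add: euclidean_representation)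
qed

text \<open>Since \<open>Ck_on\<close> sees only basis directions, the chain rule is expanded in a
  basis: the coefficients are components of partial derivatives of \<open>f\<close>, and the vectors
  are partial derivatives of \<open>g\<close> composed with \<open>f\<close>, to which the induction
  hypothesis applies.\<close>

lemma Ck_on_compose:
  assumes "open S" "open T" "Ck_on k T g" "Ck_on k S f" "f ` S \<subseteq> T"
  shows "Ck_on k S (\<lambda>x. g (f x))"
  using assms(3,4)
proof (induction k arbitrary: g)
  case 0
  then show ?case using assms(5) by (auto intro: continuous_on_compose2)
next
  case (Suc k)
  let ?D = "\<lambda>x b. \<Sum>i\<in>Basis. (frechet_derivative f (at x) b \<bullet> i) *\<^sub>R frechet_derivative g (at (f x)) i"
  show ?case
  proof (rule Ck_on_SucI[OF assms(1)])
    fix x assume x: "x \<in> S"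
    have "((\<lambda>x. g (f x)) has_derivative (\<lambda>h. frechet_derivative g (at (f x)) (frechet_derivative f (at x) h))) (at x)"
      by (rule has_derivative_compose)
        (use x Suc.prems assms(5) in \<open>auto simp: frechet_derivative_works[symmetric]\<close>)
    moreover have "g differentiable at (f x)" using x Suc.prems assms(5) by auto
    ultimately show "((\<lambda>x. g (f x)) has_derivative ?D x) (at x)"
      by (subst (asm) frechet_derivative_sum_Basis) auto
  next
    fix b :: 'a assume b: "b \<in> Basis"
    have "Ck_on k S (\<lambda>x. frechet_derivative g (at (f x)) i)" if "i \<in> Basis" for i
      by (rule Suc.IH[of "\<lambda>y. frechet_derivative g (at y) i"])
        (use Suc.prems that Ck_on_Suc_imp_Ck_on in auto)
    then show "Ck_on k S (\<lambda>x. ?D x b)"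
      by (intro Ck_on_sum Ck_on_scaleR Ck_on_inner Ck_on_const assms(1))
        (use Suc.prems b in auto)
  qed
qed

lemma Ck_on_fst: "open S \<Longrightarrow> Ck_on k S f \<Longrightarrow> Ck_on k S (\<lambda>x. fst (f x))"
  by (rule Ck_on_compose[OF _ open_UNIV Ck_on_bounded_linear[OF bounded_linear_fst]]) auto

lemma Ck_on_snd: "open S \<Longrightarrow> Ck_on k S f \<Longrightarrow> Ck_on k S (\<lambda>x. snd (f x))"
  by (rule Ck_on_compose[OF _ open_UNIV Ck_on_bounded_linear[OF bounded_linear_snd]]) auto

lemma Ck_on_id: "open S \<Longrightarrow> Ck_on k S (\<lambda>x. x)"
  by (rule Ck_on_bounded_linear[OF bounded_linear_ident])

lemma Ck_on_diff:
  assumes "open S" "Ck_on k S f" "Ck_on k S g"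
  shows "Ck_on k S (\<lambda>x. f x - g x)"
  using Ck_on_add[OF assms(1,2) Ck_on_scaleR[OF assms(1) Ck_on_const[OF assms(1), of _ "-1"] assms(3)]]
  by simp

section \<open>Reciprocal, exponential and logarithm\<close>

lemma Ck_on_inverse_real: "Ck_on k (- {0}) (inverse :: real \<Rightarrow> real)"
proof (induction k)
  case 0
  show ?case by (auto intro: continuous_intros)
next
  case (Suc k)
  show ?case
  \<comment> \<open>The derivative is a polynomial in \<open>inverse\<close> itself, so order
    \<open>k\<close> yields order \<open>Suc k\<close>.\<close>
  proof (rule Ck_on_SucI[where f' = "\<lambda>x h. (- h) * (inverse x * inverse x)"])
    show "((inverse :: real \<Rightarrow> real) has_derivative (\<lambda>h. (- h) * (inverse x * inverse x))) (at x)"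
      if "x \<in> - {0}" for x :: real
      using that by (auto intro!: derivative_eq_intros)
    show "Ck_on k (- {0}) (\<lambda>x::real. (- b) * (inverse x * inverse x))" for b
      by (intro Ck_on_mult Ck_on_const Suc.IH) auto
  qed auto
qed

lemma Ck_on_inverse:
  fixes f :: "'a::euclidean_space \<Rightarrow> real"
  assumes "open S" "Ck_on k S f" "\<And>x. x \<in> S \<Longrightarrow> f x \<noteq> 0"
  shows "Ck_on k S (\<lambda>x. inverse (f x))"
  by (rule Ck_on_compose[OF assms(1) _ Ck_on_inverse_real assms(2)]) (use assms(3) in auto)

lemma Ck_on_exp:
  fixes f :: "'a::euclidean_space \<Rightarrow> real"
  assumes "open S" "Ck_on k S f"
  shows "Ck_on k S (\<lambda>x. exp (f x))"
proof -
  have "Ck_on k UNIV (exp :: real \<Rightarrow> real)"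
  proof (induction k)
    case (Suc k)
    show ?case
      by (rule Ck_on_SucI[where f' = "\<lambda>x h. h * exp x"])
        (auto intro!: derivative_eq_intros Ck_on_mult Ck_on_const Suc.IH)
  qed (auto intro: continuous_intros)
  then show ?thesis by (rule Ck_on_compose[OF assms(1) open_UNIV _ assms(2)]) auto
qed

lemma Ck_on_ln:
  fixes f :: "'a::euclidean_space \<Rightarrow> real"
  assumes "open S" "Ck_on k S f" "\<And>x. x \<in> S \<Longrightarrow> f x > 0"
  shows "Ck_on k S (\<lambda>x. ln (f x))"
proof -
  have "Ck_on k {0<..} (ln :: real \<Rightarrow> real)"
  proof (cases k)
    case (Suc l)
    show ?thesis unfolding Suc
    proof (rule Ck_on_SucI[where f' = "\<lambda>x h. h * inverse x"])
      show "((ln :: real \<Rightarrow> real) has_derivative (\<lambda>h. h * inverse x)) (at x)" if "x \<in> {0<..}" for x :: real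
        using that by (auto intro!: derivative_eq_intros)
    qed (auto intro!: Ck_on_mult Ck_on_const Ck_on_inverse Ck_on_id)
  qed (auto intro!: continuous_intros)
  from Ck_on_compose[OF assms(1) _ this assms(2)] show ?thesis using assms(3) by force
qed

section \<open>Gronwall estimate and global existence for ordinary differential equations\<close>

text \<open>The squared norm is used because it is differentiable also where \<open>x\<close>
  vanishes. Weighted by a decaying exponential and reduced by the accumulated error e^2 (s - a), it
  becomes nonincreasing.\<close>

lemma gronwall_forward:
  fixes x :: "real \<Rightarrow> 'a::real_inner"
  assumes "a \<le> b" "0 \<le> K" "0 \<le> e"
    and der: "\<And>s. s \<in> {a..b} \<Longrightarrow> (x has_vector_derivative x' s) (at s)"
    and bnd: "\<And>s. s \<in> {a..b} \<Longrightarrow> norm (x' s) \<le> K * norm (x s) + e"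
  shows "(norm (x b))\<^sup>2 \<le> exp ((2 * K + 1) * (b - a)) * ((norm (x a))\<^sup>2 + e\<^sup>2 * (b - a))"
proof -
  \<comment> \<open>2 K is the growth rate of the squared norm; the extra 1 absorbs the cross term
    through 2 |x| e <= |x|^2 + e^2.\<close>
  define L where "L = 2 * K + 1"
  define \<phi> where "\<phi> = (\<lambda>s. exp (- L * (s - a)) * (x s \<bullet> x s) - e\<^sup>2 * (s - a))"
  have "L \<ge> 0" using assms by (simp add: L_def)
  have "\<phi> b \<le> \<phi> a"
  proof (rule DERIV_nonpos_imp_nonincreasing[OF \<open>a \<le> b\<close>])
    fix s assume "a \<le> s" "s \<le> b"
    then have s: "s \<in> {a..b}" by simp
    have sq: "((\<lambda>s. x s \<bullet> x s) has_real_derivative 2 * (x s \<bullet> x' s)) (at s)"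
      using bounded_bilinear.has_vector_derivative[OF bounded_bilinear_inner der[OF s] der[OF s]]
      by (simp add: has_real_derivative_iff_has_vector_derivative inner_commute)
    have "(\<phi> has_real_derivative exp (- L * (s - a)) * (2 * (x s \<bullet> x' s) - L * (x s \<bullet> x s)) - e\<^sup>2) (at s)"
      unfolding \<phi>_def
      by (rule derivative_eq_intros sq refl | simp add: algebra_simps)+
    moreover have "exp (- L * (s - a)) * (2 * (x s \<bullet> x' s) - L * (x s \<bullet> x s)) - e\<^sup>2 \<le> 0"
    proof -
      have "x s \<bullet> x' s \<le> norm (x s) * norm (x' s)" by (rule norm_cauchy_schwarz)
      also have "\<dots> \<le> norm (x s) * (K * norm (x s) + e)"
        using bnd[OF s] by (simp add: mult_left_mono)
      finally have "2 * (x s \<bullet> x' s) \<le> 2 * K * (norm (x s))\<^sup>2 + 2 * norm (x s) * e"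
        by (simp add: algebra_simps power2_eq_square)
      also have "\<dots> \<le> L * (norm (x s))\<^sup>2 + e\<^sup>2"
        using zero_le_power2[of "norm (x s) - e"] by (simp add: L_def power2_diff algebra_simps)
      finally have "2 * (x s \<bullet> x' s) - L * (x s \<bullet> x s) \<le> e\<^sup>2" by (simp add: dot_square_norm)
      then have "exp (- L * (s - a)) * (2 * (x s \<bullet> x' s) - L * (x s \<bullet> x s)) \<le> exp (- L * (s - a)) * e\<^sup>2"
        by (intro mult_left_mono) auto
      also have "\<dots> \<le> 1 * e\<^sup>2"
        using \<open>L \<ge> 0\<close> \<open>a \<le> s\<close> by (intro mult_right_mono) auto
      finally show ?thesis by simp
    qed
    ultimately show "\<exists>y. (\<phi> has_real_derivative y) (at s) \<and> y \<le> 0" by blast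
  qed
  then have "exp (- (L * (b - a))) * (norm (x b))\<^sup>2 \<le> (norm (x a))\<^sup>2 + e\<^sup>2 * (b - a)"
    by (simp add: \<phi>_def dot_square_norm)
  then show ?thesis
    by (simp add: exp_minus L_def inverse_eq_divide pos_divide_le_eq mult.commute)
qed

text \<open>Initial data sit at s = 0 and solutions are followed both ways; the backward case is the
  forward one after reversing time.\<close>

lemma gronwall:
  fixes x :: "real \<Rightarrow> 'a::real_inner"
  assumes "0 \<le> K" "0 \<le> e"
    and der: "\<And>s. s \<in> closed_segment a b \<Longrightarrow> (x has_vector_derivative x' s) (at s)"
    and bnd: "\<And>s. s \<in> closed_segment a b \<Longrightarrow> norm (x' s) \<le> K * norm (x s) + e"
  shows "(norm (x b))\<^sup>2 \<le> exp ((2 * K + 1) * \<bar>b - a\<bar>) * ((norm (x a))\<^sup>2 + e\<^sup>2 * \<bar>b - a\<bar>)"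
proof (cases "a \<le> b")
  case True
  then show ?thesis
    using gronwall_forward[of a b K e x x'] assms by (simp add: closed_segment_eq_real_ivl)
next
  case False
  have "((\<lambda>s. x (- s)) has_vector_derivative - x' (- s)) (at s)" if "s \<in> {- a..- b}" for s
  proof -
    have "(x has_vector_derivative x' (- s)) (at (- s))"
      using that False by (intro der) (auto simp: closed_segment_eq_real_ivl)
    then have "((x \<circ> uminus) has_vector_derivative (-1) *\<^sub>R x' (- s)) (at s)"
      by (intro vector_diff_chain_at) (auto intro!: derivative_eq_intros)
    then show ?thesis by (simp add: o_def)
  qed
  then show ?thesis
    using gronwall_forward[of "- a" "- b" K e "\<lambda>s. x (- s)" "\<lambda>s. - x' (- s)"] assms False
    by (simp add: closed_segment_eq_real_ivl abs_if)
qed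

lemma ode_solution_unique:
  fixes f :: "real \<Rightarrow> 'a::real_inner \<Rightarrow> 'a"
  assumes lip: "\<And>s x y. s \<in> closed_segment a b \<Longrightarrow> norm (f s x - f s y) \<le> K * norm (x - y)"
    and x: "\<And>s. s \<in> closed_segment a b \<Longrightarrow> (x has_vector_derivative f s (x s)) (at s)"
    and y: "\<And>s. s \<in> closed_segment a b \<Longrightarrow> (y has_vector_derivative f s (y s)) (at s)"
    and "x a = y a"
  shows "x b = y b"
proof -
  have "(norm (x b - y b))\<^sup>2 \<le> exp ((2 * \<bar>K\<bar> + 1) * \<bar>b - a\<bar>) * ((norm (x a - y a))\<^sup>2 + 0\<^sup>2 * \<bar>b - a\<bar>)"
  proof (rule gronwall[where x = "\<lambda>s. x s - y s" and x' = "\<lambda>s. f s (x s) - f s (y s)"])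
    fix s assume s: "s \<in> closed_segment a b"
    show "norm (f s (x s) - f s (y s)) \<le> \<bar>K\<bar> * norm (x s - y s) + 0"
      using lip[OF s, of "x s" "y s"] mult_right_mono[OF abs_ge_self[of K] norm_ge_zero[of "x s - y s"]] by linarith
  qed (auto intro!: has_vector_derivative_diff x y)
  then show ?thesis using \<open>x a = y a\<close> by simp
qed

section \<open>Picard iteration on the whole line\<close>

lemma continuous_has_antiderivative:
  fixes h :: "real \<Rightarrow> 'a::euclidean_space"
  assumes "continuous_on UNIV h"
  obtains F where "F 0 = c" "\<And>s. (F has_vector_derivative h s) (at s)"
proof -
  obtain F where F: "\<And>s. (F has_vector_derivative h s) (at s)"
    using einterval_antiderivative[of "-\<infinity>" "\<infinity>" h] assms
    by (auto simp: continuous_on_eq_continuous_at)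
  show thesis
    by (rule that[of "\<lambda>s. F s - F 0 + c"]) (auto intro!: derivative_eq_intros F)
qed

text \<open>Integrating |s|^k supplies the factor 1 / \<open>Suc k\<close>; along the Picard
  sequence these factors build the factorials that make it converge.\<close>

lemma norm_antiderivative_le_power:
  fixes D :: "real \<Rightarrow> 'a::real_normed_vector"
  assumes "D 0 = 0" "\<And>s. (D has_vector_derivative D' s) (at s)"
    and "\<And>s. \<bar>s\<bar> \<le> S \<Longrightarrow> norm (D' s) \<le> C * \<bar>s\<bar> ^ k"
    and "\<bar>s\<bar> \<le> S"
  shows "norm (D s) \<le> C * \<bar>s\<bar> ^ Suc k / Suc k"
proof -
  have *: "norm (D s) \<le> C * s ^ Suc k / Suc k"
    if "s > 0" "s \<le> S" "D 0 = 0" "\<And>s. (D has_vector_derivative D' s) (at s)"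
      "\<And>s. \<bar>s\<bar> \<le> S \<Longrightarrow> norm (D' s) \<le> C * \<bar>s\<bar> ^ k" for D D' :: "real \<Rightarrow> 'a" and s
  proof -
    have "norm (D s - D 0) \<le> C * s ^ Suc k / Suc k - C * 0 ^ Suc k / Suc k"
    proof (rule differentiable_bound_general[OF \<open>s > 0\<close>, where \<phi>' = "\<lambda>s. C * s ^ k" and f' = D'])
      show "continuous_on {0..s} D"
        using that(4) by (auto intro!: continuous_at_imp_continuous_on has_vector_derivative_continuous)
      show "((\<lambda>s. C * s ^ Suc k / Suc k) has_vector_derivative C * x ^ k) (at x)" for x
        unfolding has_real_derivative_iff_has_vector_derivative[symmetric]
        by (rule derivative_eq_intros refl | simp)+
      show "norm (D' x) \<le> C * x ^ k" if "0 < x" "x < s" for x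
        using \<open>\<And>s. \<bar>s\<bar> \<le> S \<Longrightarrow> norm (D' s) \<le> C * \<bar>s\<bar> ^ k\<close>[of x] that \<open>s \<le> S\<close> by simp
    qed (use that(4) in \<open>auto intro!: continuous_intros\<close>)
    then show ?thesis using that by simp
  qed
  consider "s = 0" | "s > 0" | "s < 0" by linarith
  then show ?thesis
  proof cases
    case 3
    have "((\<lambda>s. D (- s)) has_vector_derivative - D' (- t)) (at t)" for t
    proof -
      have "((D \<circ> uminus) has_vector_derivative (-1) *\<^sub>R D' (- t)) (at t)"
        by (intro vector_diff_chain_at) (auto intro!: derivative_eq_intros assms)
      then show ?thesis by (simp add: o_def)
    qed
    moreover have "norm (- D' (- t)) \<le> C * \<bar>t\<bar> ^ k" if "\<bar>t\<bar> \<le> S" for t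
      using assms(3)[of "- t"] that by simp
    ultimately have "norm (D (- (- s))) \<le> C * (- s) ^ Suc k / Suc k"
      using 3 assms(1,4) by (intro *[where D = "\<lambda>s. D (- s)"]) auto
    then show ?thesis using 3 by simp
  qed (use * assms in auto)
qed

text \<open>For every time bound the Lipschitz constant is global in the space variable, so the same
  Picard iterates converge on each [-S, S] and no local solutions have to be continued.\<close>

theorem ode_solution_exists:
  fixes f :: "real \<Rightarrow> 'a::euclidean_space \<Rightarrow> 'a"
  assumes cont: "continuous_on UNIV (\<lambda>(s, x). f s x)"
    and lip: "\<And>S. \<exists>K. \<forall>s x y. \<bar>s\<bar> \<le> S \<longrightarrow> norm (f s x - f s y) \<le> K * norm (x - y)"
  obtains x where "x 0 = x0" "\<And>s. (x has_vector_derivative f s (x s)) (at s)"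
proof -
  have contf: "continuous_on T (\<lambda>s. f s (y s))" if "continuous_on T y" for y T
  proof -
    have "continuous_on T (\<lambda>s. (s, y s))" using that by (intro continuous_on_Pair continuous_on_id)
    from continuous_on_compose2[OF cont this] show ?thesis by simp
  qed
  \<comment> \<open>Integral operator of the iteration, normalized by the value \<open>x0\<close> at
    time 0.\<close>
  define J where "J h = (SOME F. F 0 = x0 \<and> (\<forall>s. (F has_vector_derivative h s) (at s)))"
    for h :: "real \<Rightarrow> 'a"
  have J: "J h 0 = x0 \<and> (\<forall>s. (J h has_vector_derivative h s) (at s))" if h: "continuous_on UNIV h" for h
  proof -
    obtain F where "F 0 = x0 \<and> (\<forall>s. (F has_vector_derivative h s) (at s))"
      by (rule continuous_has_antiderivative[OF h, of x0]) blast
    then show ?thesis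
      unfolding J_def by (rule someI[where P = "\<lambda>F. F 0 = x0 \<and> (\<forall>s. (F has_vector_derivative h s) (at s))"])
  qed
  define X where "X = rec_nat (\<lambda>s. x0) (\<lambda>k x. J (\<lambda>s. f s (x s)))"
  have X0: "X 0 = (\<lambda>s. x0)" and XS: "X (Suc k) = J (\<lambda>s. f s (X k s))" for k by (simp_all add: X_def)
  have contX: "continuous_on UNIV (X k)" for k
  proof (induction k)
    case (Suc k)
    then show ?case unfolding XS
      using J[OF contf[OF Suc]] by (auto intro!: continuous_at_imp_continuous_on has_vector_derivative_continuous)
  qed (simp add: X0)
  have X_init: "X k 0 = x0" for k by (cases k) (auto simp: X0 XS J[OF contf[OF contX]])
  have X_der: "(X (Suc k) has_vector_derivative f s (X k s)) (at s)" for k s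
    using J[OF contf[OF contX]] by (simp add: XS)
  define x where "x s = x0 + (\<Sum>k. X (Suc k) s - X k s)" for s
  have lim: "uniform_limit {-S..S} X x sequentially" if "S > 0" for S
  proof -
    obtain K0 where K0: "\<And>s x y. \<bar>s\<bar> \<le> S \<Longrightarrow> norm (f s x - f s y) \<le> K0 * norm (x - y)"
      using lip by blast
    define K where "K = \<bar>K0\<bar>"
    have K: "norm (f s x - f s y) \<le> K * norm (x - y)" if "\<bar>s\<bar> \<le> S" for s x y
      using K0[OF that, of x y] mult_right_mono[OF abs_ge_self[of K0] norm_ge_zero[of "x - y"]]
      unfolding K_def by linarith
    have "bounded ((\<lambda>s. X 1 s - X 0 s) ` {-S..S})"
      by (intro compact_imp_bounded compact_continuous_image continuous_on_diff continuous_on_subset[OF contX]) auto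
    then obtain M where M: "\<And>s. \<bar>s\<bar> \<le> S \<Longrightarrow> norm (X 1 s - X 0 s) \<le> M"
      unfolding bounded_iff by (metis abs_le_iff atLeastAtMost_iff imageI minus_le_iff)
    have bound: "norm (X (Suc k) s - X k s) \<le> M * K ^ k / fact k * \<bar>s\<bar> ^ k" if "\<bar>s\<bar> \<le> S" for k s
      using that
    proof (induction k arbitrary: s)
      case 0
      then show ?case using M by simp
    next
      case (Suc k)
      have "norm (X (Suc (Suc k)) s - X (Suc k) s) \<le> (K * (M * K ^ k / fact k)) * \<bar>s\<bar> ^ Suc k / Suc k"
      proof (rule norm_antiderivative_le_power[where D' = "\<lambda>s. f s (X (Suc k) s) - f s (X k s)"])
        fix t assume t: "\<bar>t\<bar> \<le> S"
        show "norm (f t (X (Suc k) t) - f t (X k t)) \<le> K * (M * K ^ k / fact k) * \<bar>t\<bar> ^ k"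
          using order_trans[OF K[OF t] mult_left_mono[OF Suc.IH[OF t], of K]] by (simp add: K_def mult.assoc)
      qed (use Suc.prems in \<open>auto simp: X_init intro!: has_vector_derivative_diff X_der\<close>)
      also have "\<dots> = M * K ^ Suc k / fact (Suc k) * \<bar>s\<bar> ^ Suc k" by (simp add: field_simps)
      finally show ?case .
    qed
    have "uniform_limit {-S..S} (\<lambda>n s. \<Sum>k<n. X (Suc k) s - X k s) (\<lambda>s. \<Sum>k. X (Suc k) s - X k s) sequentially"
    proof (rule Weierstrass_m_test)
      show "summable (\<lambda>k. M * ((K * S) ^ k / fact k))"
        using summable_exp_generic[of "K * S"] by (intro summable_mult) (simp add: field_simps scaleR_conv_of_real)
      fix k s assume "s \<in> {-S..S}"
      then have s: "\<bar>s\<bar> \<le> S" by auto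
      have "M \<ge> 0" using M[OF s] norm_ge_zero order_trans by blast
      then have "M * K ^ k / fact k * \<bar>s\<bar> ^ k \<le> M * K ^ k / fact k * S ^ k"
        using s by (intro mult_left_mono power_mono) (auto simp: K_def)
      with bound[OF s, of k] show "norm (X (Suc k) s - X k s) \<le> M * ((K * S) ^ k / fact k)"
        by (simp add: power_mult_distrib field_simps)
    qed
    then have "uniform_limit {-S..S} (\<lambda>n s. x0 + (\<Sum>k<n. X (Suc k) s - X k s)) x sequentially"
      unfolding x_def by (intro uniform_limit_intros)
    moreover have "x0 + (\<Sum>k<n. X (Suc k) s - X k s) = X n s" for n s
      using sum_lessThan_telescope[of "\<lambda>k. X k s" n] by (simp add: X0)
    ultimately show ?thesis by simp
  qed
  have contx: "continuous_on UNIV x"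
  proof (rule continuous_at_imp_continuous_on, safe)
    fix s :: real
    have "continuous_on {-(\<bar>s\<bar>+1)..\<bar>s\<bar>+1} x"
      by (rule uniform_limit_theorem[OF always_eventually lim]) (auto intro: continuous_on_subset[OF contX])
    then show "isCont x s" by (rule continuous_on_interior) auto
  qed
  \<comment> \<open>The limit \<open>x\<close> is so far only continuous. One more integration gives
    a differentiable \<open>Y\<close>, and \<open>Y\<close> = \<open>x\<close> because the iterates
    converge to both.\<close>
  define Y where "Y = J (\<lambda>s. f s (x s))"
  have Y: "Y 0 = x0" "(Y has_vector_derivative f s (x s)) (at s)" for s
    using J[OF contf[OF contx]] by (auto simp: Y_def)
  have "Y s = x s" for s
  proof -
    define S where "S = \<bar>s\<bar> + 1"
    have S: "S > 0" "\<bar>s\<bar> \<le> S" by (auto simp: S_def)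
    obtain K where K: "\<And>s x y. \<bar>s\<bar> \<le> S \<Longrightarrow> norm (f s x - f s y) \<le> K * norm (x - y)"
      using lip by blast
    have "(\<lambda>k. X (Suc k) s) \<longlonglongrightarrow> Y s"
    proof (rule tendstoI)
      fix e :: real assume "e > 0"
      \<comment> \<open>Makes the final error e / 2; the 1 added to |K| keeps the denominator
        positive.\<close>
      define d where "d = e / (2 * (\<bar>K\<bar> + 1) * S)"
      have "d > 0" using \<open>e > 0\<close> S by (auto simp: d_def)
      have "\<forall>\<^sub>F k in sequentially. \<forall>t\<in>{-S..S}. dist (X k t) (x t) < d"
        using uniform_limitD[OF lim[OF \<open>S > 0\<close>] \<open>d > 0\<close>] .
      then show "\<forall>\<^sub>F k in sequentially. dist (X (Suc k) s) (Y s) < e"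
      proof eventually_elim
        case (elim k)
        have "norm (X (Suc k) s - Y s) \<le> (\<bar>K\<bar> + 1) * d * \<bar>s\<bar> ^ Suc 0 / Suc 0"
        proof (rule norm_antiderivative_le_power[where D' = "\<lambda>s. f s (X k s) - f s (x s)"])
          fix t assume t: "\<bar>t\<bar> \<le> S"
          then have "t \<in> {-S..S}" by auto
          then have "norm (X k t - x t) \<le> d" using elim by (simp add: dist_norm less_imp_le)
          then have "K * norm (X k t - x t) \<le> (\<bar>K\<bar> + 1) * d" by (intro mult_mono) auto
          then show "norm (f t (X k t) - f t (x t)) \<le> (\<bar>K\<bar> + 1) * d * \<bar>t\<bar> ^ 0"
            using K[OF t, of "X k t" "x t"] by simp
        qed (use S in \<open>auto simp: X_init Y intro!: has_vector_derivative_diff X_der Y\<close>)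
        also have "\<dots> \<le> (\<bar>K\<bar> + 1) * d * S" using S \<open>d > 0\<close> by (simp add: mult_left_mono)
        also have "\<dots> = e / 2"
        proof -
          have "L * (e / (2 * L * S)) * S = e / 2" if "L > 0" for L
            using that S by (simp add: field_simps)
          from this[of "\<bar>K\<bar> + 1"] show ?thesis by (simp add: d_def)
        qed
        finally show ?case using \<open>e > 0\<close> by (simp add: dist_norm)
      qed
    qed
    moreover have "(\<lambda>k. X (Suc k) s) \<longlonglongrightarrow> x s"
      using tendsto_uniform_limitI[OF lim[OF S(1)], of s] S(2) by (intro LIMSEQ_Suc) (simp add: abs_le_iff)
    ultimately show ?thesis by (rule LIMSEQ_unique)
  qed
  then have "Y = x" by auto
  then show thesis using that[of x] Y by simp
qed

section \<open>Smooth dependence on a parameter\<close>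

text \<open>The mean value bound reduces the claim to small variation of the derivative near
  \<open>C\<close>, and compactness makes the radius independent of \<open>p\<close>. A sum of norms
  over the basis dominates the operator norm, because continuity of the derivative is given
  direction by direction.\<close>

lemma uniformly_differentiable_on_compact:
  fixes f :: "'a::euclidean_space \<Rightarrow> 'b::euclidean_space"
  assumes "Ck_on (Suc 0) UNIV f" "compact C" "e > 0"
  obtains d where "d > 0"
    "\<And>p q. p \<in> C \<Longrightarrow> norm q < d \<Longrightarrow> norm (f (p + q) - f p - frechet_derivative f (at p) q) \<le> e * norm q"
proof -
  let ?D = "\<lambda>p. frechet_derivative f (at p)"
  let ?g = "\<lambda>(q, p). \<Sum>b\<in>Basis. norm (?D (p + q) b - ?D p b)"
  have D: "(f has_derivative ?D p) (at p)" for p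
    using Ck_on_Suc_imp_has_derivative[OF assms(1)] by simp
  have cont: "continuous_on UNIV (\<lambda>p. ?D p b)" if "b \<in> Basis" for b using assms(1) that by simp
  have "continuous_on (UNIV \<times> C) ?g"
    unfolding split_beta
    by (intro continuous_on_sum continuous_on_norm continuous_on_diff
        continuous_on_compose2[OF cont] continuous_intros) auto
  from continuous_on_prod_compactE[OF this \<open>compact C\<close> UNIV_I[of 0] \<open>e > 0\<close>]
  obtain Q where Q: "0 \<in> Q" "open Q" "\<forall>q\<in>Q. \<forall>p\<in>C. dist (?g (q, p)) (?g (0, p)) \<le> e"
    by auto
  from Q obtain d where d: "d > 0" "ball 0 d \<subseteq> Q" by (meson openE)
  show thesis
  proof (rule that[OF \<open>d > 0\<close>])
    fix p q :: 'a assume p: "p \<in> C" and q: "norm q < d"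
    have "norm (f (p + q) - f p - ?D p ((p + q) - p)) \<le> norm ((p + q) - p) * e"
    proof (rule differentiable_bound_linearization[where S = "ball p d"])
      fix x assume x: "x \<in> ball p d"
      show "(f has_derivative ?D x) (at x within ball p d)"
        using D by (rule has_derivative_at_withinI)
      have "x - p \<in> Q" using x d by (auto simp: dist_norm norm_minus_commute)
      then have le: "(\<Sum>b\<in>Basis. norm (?D x b - ?D p b)) \<le> e"
        using Q(3) p by (force simp: dist_real_def)
      show "onorm (?D x - ?D p) \<le> e"
      proof (rule onorm_le)
        fix v
        have lin: "linear (\<lambda>v. ?D x v - ?D p v)"
          using linear_compose_sub[of "?D x" "?D p"] has_derivative_linear[OF D] by blast
        have "?D x v - ?D p v = (\<Sum>b\<in>Basis. (v \<bullet> b) *\<^sub>R (?D x b - ?D p b))"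
          using linear_sum[OF lin, of "\<lambda>b. (v \<bullet> b) *\<^sub>R b" Basis] linear_cmul[OF lin]
          by (simp add: euclidean_representation)
        also have "norm \<dots> \<le> (\<Sum>b\<in>Basis. norm v * norm (?D x b - ?D p b))"
          by (rule sum_norm_le) (auto intro!: mult_right_mono Basis_le_norm)
        also have "\<dots> \<le> norm v * e"
          using le by (simp flip: sum_distrib_left add: mult_left_mono)
        finally show "norm ((?D x - ?D p) v) \<le> e * norm v" by (simp add: mult.commute)
      qed
    next
      fix t :: real assume "t \<in> {0..1}"
      then have "\<bar>t\<bar> * norm q \<le> 1 * norm q" by (intro mult_right_mono) auto
      then show "p + t *\<^sub>R (p + q - p) \<in> ball p d" using q by (simp add: dist_norm)
    qed (use d in auto)
    then show "norm (f (p + q) - f p - ?D p q) \<le> e * norm q" by (simp add: mult.commute)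
  qed
qed

text \<open>Hands a Lipschitz bound along a single direction over to the derivative. The equations
  considered are Lipschitz in the space variable alone, so only those directions are
  bounded.\<close>

lemma norm_directional_derivative_le:
  assumes "(f has_derivative D) (at p)" "\<And>t. t > 0 \<Longrightarrow> norm (f (p + t *\<^sub>R v) - f p) \<le> t * B"
  shows "norm (D v) \<le> B"
proof -
  interpret D: bounded_linear D using assms(1) by (rule has_derivative_bounded_linear)
  have "((\<lambda>t. f (p + t *\<^sub>R v)) has_derivative (\<lambda>t. D (t *\<^sub>R v))) (at 0)"
    by (rule has_derivative_compose[where g = f and f = "\<lambda>t. p + t *\<^sub>R v"])
      (auto intro!: derivative_eq_intros assms)
  then have lin: "\<exists>d>0. \<forall>t. \<bar>t\<bar> < d \<longrightarrow> norm (f (p + t *\<^sub>R v) - f p - t *\<^sub>R D v) \<le> e * \<bar>t\<bar>"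
    if "e > 0" for e
    using that by (simp add: has_derivative_at_alt D.scaleR)
  show ?thesis
  proof (rule field_le_epsilon)
    fix e :: real assume "e > 0"
    then obtain d where d: "d > 0"
      "\<And>t. \<bar>t\<bar> < d \<Longrightarrow> norm (f (p + t *\<^sub>R v) - f p - t *\<^sub>R D v) \<le> e * \<bar>t\<bar>"
      using lin by blast
    define t where "t = d / 2"
    have t: "t > 0" "t < d" using d by (auto simp: t_def)
    have "t * norm (D v) = norm (t *\<^sub>R D v)" using t by simp
    also have "\<dots> \<le> norm (f (p + t *\<^sub>R v) - f p) + norm (f (p + t *\<^sub>R v) - f p - t *\<^sub>R D v)"
      using norm_triangle_sub[of "t *\<^sub>R D v" "f (p + t *\<^sub>R v) - f p"] by (simp add: norm_minus_commute)
    also have "\<dots> \<le> t * B + e * t" using assms(2)[of t] d(2)[of t] t by simp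
    finally have "t * norm (D v) \<le> t * (B + e)" by (simp add: algebra_simps)
    then show "norm (D v) \<le> B + e" using t by simp
  qed
qed

text \<open>The right-hand side is merely continuous in the parameter. Its variation is therefore
  measured along the fixed solution \<open>X \<beta>0\<close>, whose graph over [-S, S] is compact;
  the Lipschitz bound in space handles the rest.\<close>

lemma flow_uniform_limit:
  fixes f :: "real \<times> real \<times> 'a::euclidean_space \<Rightarrow> 'a"
  assumes cont: "continuous_on UNIV f"
    and lip: "\<And>S. \<exists>K. \<forall>\<beta> s x y. \<bar>s\<bar> \<le> S \<longrightarrow> norm (f (\<beta>, s, x) - f (\<beta>, s, y)) \<le> K * norm (x - y)"
    and X: "\<And>\<beta> s. (X \<beta> has_vector_derivative f (\<beta>, s, X \<beta> s)) (at s)"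
    and init: "\<And>\<beta>. X \<beta> 0 = a + \<beta> *\<^sub>R b"
    and "S > 0"
  shows "uniform_limit {-S..S} X (X \<beta>0) (at \<beta>0)"
proof (rule uniform_limitI)
  fix e :: real assume "e > 0"
  obtain K0 where K0: "\<And>\<beta> s x y. \<bar>s\<bar> \<le> S \<Longrightarrow> norm (f (\<beta>, s, x) - f (\<beta>, s, y)) \<le> K0 * norm (x - y)"
    using lip by blast
  define K where "K = \<bar>K0\<bar>"
  have K: "norm (f (\<beta>, s, x) - f (\<beta>, s, y)) \<le> K * norm (x - y)" if "\<bar>s\<bar> \<le> S" for \<beta> s x y
    using K0[OF that, of \<beta> x y] mult_right_mono[OF abs_ge_self[of K0] norm_ge_zero[of "x - y"]]
    unfolding K_def by linarith
  \<comment> \<open>For parameters within \<open>d\<close> and a defect of at most \<open>d\<close>,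
    the Gronwall bound becomes d^2 Q; the choice d = e / (1 + Q) brings it below e^2.\<close>
  define Q where "Q = exp ((2 * K + 1) * S) * ((norm b)\<^sup>2 + S)"
  define d where "d = e / (1 + Q)"
  have "Q \<ge> 0" using \<open>S > 0\<close> by (simp add: Q_def)
  then have "d > 0" using \<open>e > 0\<close> by (simp add: d_def)
  have d_less: "d\<^sup>2 * Q < e\<^sup>2"
  proof -
    have "Q < (1 + Q)\<^sup>2" using \<open>Q \<ge> 0\<close> by (simp add: power2_eq_square algebra_simps add_pos_nonneg)
    then have "e\<^sup>2 * Q < e\<^sup>2 * (1 + Q)\<^sup>2" using \<open>e > 0\<close> by simp
    then show ?thesis using \<open>Q \<ge> 0\<close> by (simp add: d_def power_divide field_simps)
  qed
  have contX: "continuous_on T (X \<beta>)" for T \<beta>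
    using X by (auto intro!: continuous_at_imp_continuous_on has_vector_derivative_continuous)
  have cont_tube: "continuous_on (UNIV \<times> {-S..S}) (\<lambda>(\<beta>, s). f (\<beta>, s, X \<beta>0 s))"
    unfolding split_beta
    by (intro continuous_on_compose2[OF cont] continuous_intros continuous_on_compose2[OF contX]) auto
  obtain B where B: "\<beta>0 \<in> B" "open B"
    and B_le: "\<forall>\<beta>\<in>B \<inter> UNIV. \<forall>s\<in>{-S..S}. dist ((\<lambda>(\<beta>, s). f (\<beta>, s, X \<beta>0 s)) (\<beta>, s))
      ((\<lambda>(\<beta>, s). f (\<beta>, s, X \<beta>0 s)) (\<beta>0, s)) \<le> d"
    by (rule continuous_on_prod_compactE[OF cont_tube compact_Icc UNIV_I[of \<beta>0] \<open>d > 0\<close>])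
  have B_norm: "norm (f (\<beta>, s, X \<beta>0 s) - f (\<beta>0, s, X \<beta>0 s)) \<le> d" if "\<beta> \<in> B" "s \<in> {-S..S}" for \<beta> s
    using B_le that by (simp add: dist_norm)
  have "\<forall>\<^sub>F \<beta> in at \<beta>0. \<beta> \<in> B" using B by (intro eventually_at_in_open')
  moreover have "\<forall>\<^sub>F \<beta> in at \<beta>0. dist \<beta> \<beta>0 < d" using \<open>d > 0\<close> by (auto simp: eventually_at)
  ultimately show "\<forall>\<^sub>F \<beta> in at \<beta>0. \<forall>s\<in>{-S..S}. dist (X \<beta> s) (X \<beta>0 s) < e"
  proof eventually_elim
    case (elim \<beta>)
    show ?case
    proof
      fix s assume s: "s \<in> {-S..S}"
      have sub: "t \<in> {-S..S}" if "t \<in> closed_segment 0 s" for t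
        using that s by (auto simp: closed_segment_eq_real_ivl split: if_splits)
      have "(norm (X \<beta> s - X \<beta>0 s))\<^sup>2 \<le> exp ((2 * K + 1) * \<bar>s - 0\<bar>) * ((norm (X \<beta> 0 - X \<beta>0 0))\<^sup>2 + d\<^sup>2 * \<bar>s - 0\<bar>)"
      proof (rule gronwall[where x' = "\<lambda>s. f (\<beta>, s, X \<beta> s) - f (\<beta>0, s, X \<beta>0 s)"])
        fix t assume "t \<in> closed_segment 0 s"
        then have t: "t \<in> {-S..S}" by (rule sub)
        have "norm (f (\<beta>, t, X \<beta> t) - f (\<beta>0, t, X \<beta>0 t)) \<le>
            norm (f (\<beta>, t, X \<beta> t) - f (\<beta>, t, X \<beta>0 t)) + norm (f (\<beta>, t, X \<beta>0 t) - f (\<beta>0, t, X \<beta>0 t))"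
          using norm_triangle_ineq[of "f (\<beta>, t, X \<beta> t) - f (\<beta>, t, X \<beta>0 t)"
              "f (\<beta>, t, X \<beta>0 t) - f (\<beta>0, t, X \<beta>0 t)"] by simp
        moreover have "\<bar>t\<bar> \<le> S" using t by auto
        note K[OF this, of \<beta> "X \<beta> t" "X \<beta>0 t"] B_norm[OF elim(1) t]
        ultimately show "norm (f (\<beta>, t, X \<beta> t) - f (\<beta>0, t, X \<beta>0 t)) \<le> K * norm (X \<beta> t - X \<beta>0 t) + d"
          by linarith
      qed (use \<open>d > 0\<close> in \<open>auto simp: K_def intro!: has_vector_derivative_diff X\<close>)
      also have "X \<beta> 0 - X \<beta>0 0 = (\<beta> - \<beta>0) *\<^sub>R b" by (simp add: init algebra_simps)
      also have "exp ((2 * K + 1) * \<bar>s - 0\<bar>) * ((norm ((\<beta> - \<beta>0) *\<^sub>R b))\<^sup>2 + d\<^sup>2 * \<bar>s - 0\<bar>)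
          \<le> exp ((2 * K + 1) * S) * (d\<^sup>2 * (norm b)\<^sup>2 + d\<^sup>2 * S)"
      proof (intro mult_mono add_mono)
        have "\<bar>\<beta> - \<beta>0\<bar>\<^sup>2 \<le> d\<^sup>2" using elim(2) by (intro power_mono) (auto simp: dist_real_def)
        then show "(norm ((\<beta> - \<beta>0) *\<^sub>R b))\<^sup>2 \<le> d\<^sup>2 * (norm b)\<^sup>2"
          by (simp add: power_mult_distrib mult_right_mono)
        have "(2 * K + 1) * \<bar>s - 0\<bar> \<le> (2 * K + 1) * S" using s by (intro mult_left_mono) (auto simp: K_def)
        then show "exp ((2 * K + 1) * \<bar>s - 0\<bar>) \<le> exp ((2 * K + 1) * S)" by simp
      qed (use s in auto)
      also have "\<dots> = d\<^sup>2 * Q" by (simp add: Q_def algebra_simps)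
      finally have "(norm (X \<beta> s - X \<beta>0 s))\<^sup>2 < e\<^sup>2" using d_less by simp
      then show "dist (X \<beta> s) (X \<beta>0 s) < e" using \<open>e > 0\<close> by (simp add: dist_norm power_less_imp_less_base)
    qed
  qed
qed

lemma flow_continuous:
  fixes f :: "real \<times> real \<times> 'a::euclidean_space \<Rightarrow> 'a"
  assumes cont: "continuous_on UNIV f"
    and lip: "\<And>S. \<exists>K. \<forall>\<beta> s x y. \<bar>s\<bar> \<le> S \<longrightarrow> norm (f (\<beta>, s, x) - f (\<beta>, s, y)) \<le> K * norm (x - y)"
    and X: "\<And>\<beta> s. (X \<beta> has_vector_derivative f (\<beta>, s, X \<beta> s)) (at s)"
    and init: "\<And>\<beta>. X \<beta> 0 = a + \<beta> *\<^sub>R b"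
  shows "continuous_on UNIV (\<lambda>p. X (fst p) (snd p))"
proof (rule continuous_at_imp_continuous_on, safe)
  fix \<beta>0 s0 :: real
  define S where "S = \<bar>s0\<bar> + 1"
  show "isCont (\<lambda>p. X (fst p) (snd p)) (\<beta>0, s0)"
    unfolding continuous_at_eps_delta
  proof (intro allI impI)
    fix e :: real assume "e > 0"
    have "\<forall>\<^sub>F \<beta> in at \<beta>0. \<forall>s\<in>{-S..S}. dist (X \<beta> s) (X \<beta>0 s) < e / 2"
      using \<open>e > 0\<close> by (intro uniform_limitD[OF flow_uniform_limit[OF cont lip X init]]) (auto simp: S_def)
    then obtain d1 where d1: "d1 > 0"
      "\<And>\<beta> s. dist \<beta> \<beta>0 < d1 \<Longrightarrow> s \<in> {-S..S} \<Longrightarrow> dist (X \<beta> s) (X \<beta>0 s) < e / 2"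
      unfolding eventually_at by (metis \<open>e > 0\<close> UNIV_I dist_self half_gt_zero)
    have "isCont (X \<beta>0) s0" using X by (rule has_vector_derivative_continuous)
    then obtain d2 where d2: "d2 > 0" "\<And>s. dist s s0 < d2 \<Longrightarrow> dist (X \<beta>0 s) (X \<beta>0 s0) < e / 2"
      unfolding continuous_at_eps_delta using \<open>e > 0\<close> half_gt_zero by blast
    show "\<exists>d>0. \<forall>p. dist p (\<beta>0, s0) < d \<longrightarrow> dist (X (fst p) (snd p)) (X (fst (\<beta>0, s0)) (snd (\<beta>0, s0))) < e"
    proof (intro exI[of _ "min 1 (min d1 d2)"] conjI allI impI)
      fix p assume p: "dist p (\<beta>0, s0) < min 1 (min d1 d2)"
      have "dist (fst p) \<beta>0 < d1" "dist (snd p) s0 < d2" "dist (snd p) s0 < 1"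
        using p dist_fst_le[of p "(\<beta>0, s0)"] dist_snd_le[of p "(\<beta>0, s0)"] by auto
      moreover from this have "snd p \<in> {-S..S}" by (auto simp: S_def dist_real_def)
      ultimately have "dist (X (fst p) (snd p)) (X \<beta>0 (snd p)) < e / 2" "dist (X \<beta>0 (snd p)) (X \<beta>0 s0) < e / 2"
        using d1 d2 by auto
      then show "dist (X (fst p) (snd p)) (X (fst (\<beta>0, s0)) (snd (\<beta>0, s0))) < e"
        using dist_triangle[of "X (fst p) (snd p)" "X \<beta>0 s0" "X \<beta>0 (snd p)"] by simp
    qed (use d1 d2 in auto)
  qed
qed

text \<open>\<open>Z\<close> solves the equation linearized along \<open>X \<beta>0\<close>. The
  remainder \<open>\<delta>\<close> of the first-order expansion then satisfies a Gronwall
  inequality whose defect is an arbitrarily small multiple of the parameter increment.\<close>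

lemma flow_differentiable_parameter:
  fixes f :: "real \<times> real \<times> 'a::euclidean_space \<Rightarrow> 'a"
  assumes C1: "Ck_on (Suc 0) UNIV f"
    and lip: "\<And>S. \<exists>K. \<forall>\<beta> s x y. \<bar>s\<bar> \<le> S \<longrightarrow> norm (f (\<beta>, s, x) - f (\<beta>, s, y)) \<le> K * norm (x - y)"
    and X: "\<And>\<beta> s. (X \<beta> has_vector_derivative f (\<beta>, s, X \<beta> s)) (at s)"
    and init: "\<And>\<beta>. X \<beta> 0 = a + \<beta> *\<^sub>R b"
    and Z: "\<And>s. (Z has_vector_derivative frechet_derivative f (at (\<beta>0, s, X \<beta>0 s)) (1, 0, Z s)) (at s)"
    and "Z 0 = b"
  shows "((\<lambda>\<beta>. X \<beta> s) has_vector_derivative Z s) (at \<beta>0)"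
proof -
  let ?D = "\<lambda>t. frechet_derivative f (at (\<beta>0, t, X \<beta>0 t))"
  define S where "S = \<bar>s\<bar> + 1"
  have "S > 0" by (simp add: S_def)
  obtain K0 where K0: "\<And>\<beta> s x y. \<bar>s\<bar> \<le> S \<Longrightarrow> norm (f (\<beta>, s, x) - f (\<beta>, s, y)) \<le> K0 * norm (x - y)"
    using lip by blast
  define K where "K = \<bar>K0\<bar>"
  have K: "norm (f (\<beta>, s, x) - f (\<beta>, s, y)) \<le> K * norm (x - y)" if "\<bar>s\<bar> \<le> S" for \<beta> s x y
    using K0[OF that, of \<beta> x y] mult_right_mono[OF abs_ge_self[of K0] norm_ge_zero[of "x - y"]]
    unfolding K_def by linarith
  have D: "(f has_derivative ?D t) (at (\<beta>0, t, X \<beta>0 t))" for t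
    using Ck_on_Suc_imp_has_derivative[OF C1] by simp
  have DK: "norm (?D t (0, 0, z)) \<le> K * norm z" if "\<bar>t\<bar> \<le> S" for t z
  proof (rule norm_directional_derivative_le[OF D])
    fix r :: real assume "r > 0"
    then show "norm (f ((\<beta>0, t, X \<beta>0 t) + r *\<^sub>R (0, 0, z)) - f (\<beta>0, t, X \<beta>0 t)) \<le> r * (K * norm z)"
      using K[OF that, of \<beta>0 "X \<beta>0 t + r *\<^sub>R z" "X \<beta>0 t"] by (simp add: algebra_simps)
  qed
  have contX: "continuous_on T (X \<beta>)" for T \<beta>
    using X by (auto intro!: continuous_at_imp_continuous_on has_vector_derivative_continuous)
  have contZ: "continuous_on T Z" for T
    using Z by (auto intro!: continuous_at_imp_continuous_on has_vector_derivative_continuous)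
  have "bounded (Z ` {-S..S})"
    by (intro compact_imp_bounded compact_continuous_image contZ) auto
  then obtain N where N: "N > 0" "\<And>t. t \<in> {-S..S} \<Longrightarrow> norm (Z t) \<le> N" unfolding bounded_pos by blast
  define C where "C = (\<lambda>t. (\<beta>0, t, X \<beta>0 t)) ` {-S..S}"
  have "compact C" unfolding C_def by (intro compact_continuous_image continuous_intros contX) auto
  define Q where "Q = exp ((2 * (K + 1) + 1) * S) * (1 + N)\<^sup>2 * S"
  have "Q \<ge> 0" using \<open>S > 0\<close> by (simp add: Q_def)
  show ?thesis
    unfolding has_vector_derivative_def has_derivative_at_alt
  proof (intro conjI allI impI bounded_linear_scaleR_left)
    fix e :: real assume "e > 0"
    \<comment> \<open>The bound 1 lets the term \<eta> |\<delta>| be absorbed by raising K to K + 1;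
      the bound e / (1 + Q) turns the final factor \<eta>^2 Q into at most e^2.\<close>
    define \<eta> where "\<eta> = min 1 (e / (1 + Q))"
    have \<eta>: "\<eta> > 0" "\<eta> \<le> 1" using \<open>e > 0\<close> \<open>Q \<ge> 0\<close> by (auto simp: \<eta>_def)
    have \<eta>Q: "\<eta>\<^sup>2 * Q \<le> e\<^sup>2"
    proof -
      have "Q \<le> (1 + Q)\<^sup>2" using \<open>Q \<ge> 0\<close> by (simp add: power2_eq_square algebra_simps)
      then have "e\<^sup>2 * Q \<le> e\<^sup>2 * (1 + Q)\<^sup>2" by (intro mult_left_mono) auto
      then have "(e / (1 + Q))\<^sup>2 * Q \<le> e\<^sup>2" using \<open>Q \<ge> 0\<close> by (simp add: power_divide field_simps)
      moreover have "\<eta>\<^sup>2 \<le> (e / (1 + Q))\<^sup>2" using \<eta> by (intro power_mono) (auto simp: \<eta>_def)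
      ultimately show ?thesis using \<open>Q \<ge> 0\<close> by (meson mult_right_mono order_trans)
    qed
    obtain d where d: "d > 0" "\<And>p q. p \<in> C \<Longrightarrow> norm q < d \<Longrightarrow>
        norm (f (p + q) - f p - frechet_derivative f (at p) q) \<le> \<eta> * norm q"
      by (rule uniformly_differentiable_on_compact[OF C1 \<open>compact C\<close> \<open>\<eta> > 0\<close>]) blast
    have "\<forall>\<^sub>F \<beta> in at \<beta>0. \<forall>t\<in>{-S..S}. dist (X \<beta> t) (X \<beta>0 t) < d / 2"
      using d(1) \<open>S > 0\<close>
      by (intro uniform_limitD[OF flow_uniform_limit[OF Ck_on_imp_continuous_on[OF C1] lip X init]]) auto
    then obtain d1 where d1: "d1 > 0"
      "\<And>\<beta> t. dist \<beta> \<beta>0 < d1 \<Longrightarrow> t \<in> {-S..S} \<Longrightarrow> dist (X \<beta> t) (X \<beta>0 t) < d / 2"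
      unfolding eventually_at by (metis d(1) UNIV_I dist_self half_gt_zero)
    show "\<exists>d>0. \<forall>\<beta>. norm (\<beta> - \<beta>0) < d \<longrightarrow>
        norm (X \<beta> s - X \<beta>0 s - (\<beta> - \<beta>0) *\<^sub>R Z s) \<le> e * norm (\<beta> - \<beta>0)"
    proof (intro exI[of _ "min (d / 2) d1"] conjI allI impI)
      fix \<beta> assume \<beta>: "norm (\<beta> - \<beta>0) < min (d / 2) d1"
      define h where "h = \<beta> - \<beta>0"
      have h: "\<bar>h\<bar> < d / 2" using \<beta> by (simp add: h_def)
      define \<delta> where "\<delta> = (\<lambda>t. X \<beta> t - X \<beta>0 t - h *\<^sub>R Z t)"
      define \<epsilon> where "\<epsilon> = \<eta> * (1 + N) * \<bar>h\<bar>"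
      have sub: "t \<in> {-S..S}" if "t \<in> closed_segment 0 s" for t
        using that by (auto simp: closed_segment_eq_real_ivl S_def split: if_splits)
      have "(norm (\<delta> s))\<^sup>2 \<le> exp ((2 * (K + 1) + 1) * \<bar>s - 0\<bar>) * ((norm (\<delta> 0))\<^sup>2 + \<epsilon>\<^sup>2 * \<bar>s - 0\<bar>)"
      proof (rule gronwall[where x' = "\<lambda>t. f (\<beta>, t, X \<beta> t) - f (\<beta>0, t, X \<beta>0 t) - h *\<^sub>R ?D t (1, 0, Z t)"])
        fix t assume "t \<in> closed_segment 0 s"
        then have t: "t \<in> {-S..S}" by (rule sub)
        interpret D: bounded_linear "?D t" using D by (rule has_derivative_bounded_linear)
        \<comment> \<open>Increment of the argument of \<open>f\<close>; its time component is 0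
          because both solutions are compared at the same time.\<close>
        define q where "q = (h, 0::real, X \<beta> t - X \<beta>0 t)"
        have q_le: "norm q \<le> \<bar>h\<bar> + norm (X \<beta> t - X \<beta>0 t)"
          using norm_Pair_le[of h "(0::real, X \<beta> t - X \<beta>0 t)"] norm_Pair_le[of "0::real" "X \<beta> t - X \<beta>0 t"]
          by (simp add: q_def)
        have "norm (X \<beta> t - X \<beta>0 t) < d / 2" using d1(2)[OF _ t, of \<beta>] \<beta> by (simp add: dist_norm)
        then have "norm q < d" using q_le h by simp
        then have "norm (f ((\<beta>0, t, X \<beta>0 t) + q) - f (\<beta>0, t, X \<beta>0 t) - ?D t q) \<le> \<eta> * norm q"
          using t by (intro d(2)) (auto simp: C_def)
        also have "(\<beta>0, t, X \<beta>0 t) + q = (\<beta>, t, X \<beta> t)" by (simp add: q_def h_def)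
        also have "?D t q = h *\<^sub>R ?D t (1, 0, Z t) + ?D t (0, 0, \<delta> t)"
          unfolding D.scaleR[symmetric] D.add[symmetric] by (simp add: q_def \<delta>_def)
        finally have "norm (f (\<beta>, t, X \<beta> t) - f (\<beta>0, t, X \<beta>0 t) - h *\<^sub>R ?D t (1, 0, Z t) - ?D t (0, 0, \<delta> t)) \<le> \<eta> * norm q"
          by (simp only: diff_diff_eq add.assoc)
        moreover have "norm (?D t (0, 0, \<delta> t)) \<le> K * norm (\<delta> t)" using t by (intro DK) auto
        \<comment> \<open>The increment of \<open>X\<close> is split into the remainder and h Z, so
          the estimate refers back to \<open>\<delta>\<close> and closes under Gronwall.\<close>
        moreover have "\<eta> * norm q \<le> norm (\<delta> t) + \<epsilon>"
        proof -
          have "norm (X \<beta> t - X \<beta>0 t) \<le> norm (\<delta> t) + norm (h *\<^sub>R Z t)"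
            using norm_triangle_ineq[of "\<delta> t" "h *\<^sub>R Z t"] by (simp add: \<delta>_def)
          also have "norm (h *\<^sub>R Z t) \<le> \<bar>h\<bar> * N" using N(2)[OF t] by (simp add: mult_left_mono)
          finally have "norm q \<le> norm (\<delta> t) + (1 + N) * \<bar>h\<bar>" using q_le by (simp add: algebra_simps)
          then have "\<eta> * norm q \<le> \<eta> * (norm (\<delta> t) + (1 + N) * \<bar>h\<bar>)" using \<eta> by (intro mult_left_mono) auto
          also have "\<dots> \<le> norm (\<delta> t) + \<epsilon>"
            using mult_right_mono[OF \<eta>(2) norm_ge_zero[of "\<delta> t"]] by (simp add: \<epsilon>_def algebra_simps)
          finally show ?thesis .
        qed
        ultimately show "norm (f (\<beta>, t, X \<beta> t) - f (\<beta>0, t, X \<beta>0 t) - h *\<^sub>R ?D t (1, 0, Z t)) \<le> (K + 1) * norm (\<delta> t) + \<epsilon>"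
          using norm_triangle_sub[of "f (\<beta>, t, X \<beta> t) - f (\<beta>0, t, X \<beta>0 t) - h *\<^sub>R ?D t (1, 0, Z t)" "?D t (0, 0, \<delta> t)"]
          by (simp add: algebra_simps)
      next
        fix t show "(\<delta> has_vector_derivative f (\<beta>, t, X \<beta> t) - f (\<beta>0, t, X \<beta>0 t) - h *\<^sub>R ?D t (1, 0, Z t)) (at t)"
          unfolding \<delta>_def by (auto intro!: derivative_eq_intros X Z)
      qed (use N \<eta> in \<open>auto simp: K_def \<epsilon>_def\<close>)
      also have "\<delta> 0 = 0" by (simp add: \<delta>_def init \<open>Z 0 = b\<close> h_def algebra_simps)
      also have "exp ((2 * (K + 1) + 1) * \<bar>s - 0\<bar>) * ((norm (0::'a))\<^sup>2 + \<epsilon>\<^sup>2 * \<bar>s - 0\<bar>)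
          \<le> exp ((2 * (K + 1) + 1) * S) * (\<epsilon>\<^sup>2 * S)"
      proof (intro mult_mono)
        have "(2 * (K + 1) + 1) * \<bar>s - 0\<bar> \<le> (2 * (K + 1) + 1) * S"
          by (intro mult_left_mono) (auto simp: K_def S_def)
        then show "exp ((2 * (K + 1) + 1) * \<bar>s - 0\<bar>) \<le> exp ((2 * (K + 1) + 1) * S)" by simp
        show "(norm (0::'a))\<^sup>2 + \<epsilon>\<^sup>2 * \<bar>s - 0\<bar> \<le> \<epsilon>\<^sup>2 * S" by (simp add: S_def mult_left_mono)
      qed auto
      also have "\<dots> = \<eta>\<^sup>2 * Q * h\<^sup>2" by (simp add: \<epsilon>_def Q_def power_mult_distrib)
      also have "\<dots> \<le> e\<^sup>2 * h\<^sup>2" using \<eta>Q by (intro mult_right_mono) auto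
      also have "\<dots> = (e * \<bar>h\<bar>)\<^sup>2" by (simp add: power_mult_distrib)
      finally have "norm (\<delta> s) \<le> e * \<bar>h\<bar>"
        by (rule power2_le_imp_le) (use \<open>e > 0\<close> in auto)
      then show "norm (X \<beta> s - X \<beta>0 s - (\<beta> - \<beta>0) *\<^sub>R Z s) \<le> e * norm (\<beta> - \<beta>0)"
        by (simp add: \<delta>_def h_def)
    qed (use d d1 in auto)
  qed
qed

text \<open>Initial data affine in the parameter form a class closed under linearization: the
  derivative in \<beta> starts at the constant \<open>b\<close>, which is affine with zero slope.
  Hence the induction generalizes over \<open>f\<close>, \<open>X\<close>, \<open>a\<close> and
  \<open>b\<close>.\<close>

theorem flow_Ck:
  fixes f :: "real \<times> real \<times> 'a::euclidean_space \<Rightarrow> 'a"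
  assumes "Ck_on k UNIV f"
    and "\<And>S. \<exists>K. \<forall>\<beta> s x y. \<bar>s\<bar> \<le> S \<longrightarrow> norm (f (\<beta>, s, x) - f (\<beta>, s, y)) \<le> K * norm (x - y)"
    and "\<And>\<beta> s. (X \<beta> has_vector_derivative f (\<beta>, s, X \<beta> s)) (at s)"
    and "\<And>\<beta>. X \<beta> 0 = a + \<beta> *\<^sub>R b"
  shows "Ck_on k UNIV (\<lambda>p. X (fst p) (snd p))"
  using assms
proof (induction k arbitrary: f X a b)
  case 0
  show ?case
    using flow_continuous[of f X a b, OF _ 0(2,3,4)] 0(1) by simp
next
  case (Suc k)
  note lip = Suc.prems(2) and X = Suc.prems(3) and init = Suc.prems(4)
  let ?D = "\<lambda>p. frechet_derivative f (at p)"
  have Ckf: "Ck_on k UNIV f" using Suc.prems(1) by (rule Ck_on_Suc_imp_Ck_on)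
  have C1: "Ck_on (Suc 0) UNIV f"
    using Suc.prems(1) by (auto dest: Ck_on_imp_continuous_on)
  have D: "(f has_derivative ?D p) (at p)" for p
    using Ck_on_Suc_imp_has_derivative[OF C1] by simp
  \<comment> \<open>Order \<open>k\<close> of the flow has to be known first, since the coefficients
    of the linearized equation are evaluated along \<open>X\<close>.\<close>
  have CkX: "Ck_on k UNIV (\<lambda>p. X (fst p) (snd p))"
    by (rule Suc.IH[OF Ckf lip X init])
  \<comment> \<open>Right-hand side of the linearized equation, which \<open>\<partial>X / \<partial>\<beta>\<close> solves. It is again of the type considered,
    with one derivative fewer, so the induction hypothesis applies to it.\<close>
  define F where "F = (\<lambda>p. ?D (fst p, fst (snd p), X (fst p) (fst (snd p))) (1, 0, snd (snd p)))"
  have CkF: "Ck_on k UNIV F"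
  proof -
    have P: "Ck_on k UNIV (\<lambda>p::real \<times> real \<times> 'a. (fst p, fst (snd p), X (fst p) (fst (snd p))))"
      by (intro Ck_on_Pair Ck_on_fst Ck_on_snd Ck_on_id open_UNIV
          Ck_on_compose[OF open_UNIV open_UNIV CkX, where f = "\<lambda>p. (fst p, fst (snd p))", simplified])
    have DP: "Ck_on k UNIV (\<lambda>p::real \<times> real \<times> 'a. ?D (fst p, fst (snd p), X (fst p) (fst (snd p))) b)" if "b \<in> Basis" for b
      by (rule Ck_on_compose[OF open_UNIV open_UNIV _ P, where g = "\<lambda>p. ?D p b"]) (use Suc.prems(1) that in auto)
    have "F = (\<lambda>p. \<Sum>b\<in>Basis. ((1, 0, snd (snd p)) \<bullet> b) *\<^sub>R ?D (fst p, fst (snd p), X (fst p) (fst (snd p))) b)"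
      unfolding F_def
      by (rule ext, rule frechet_derivative_sum_Basis) (use D in \<open>auto simp: differentiable_def\<close>)
    then show ?thesis
      by (simp only:) (intro Ck_on_sum Ck_on_scaleR Ck_on_inner Ck_on_Pair Ck_on_const Ck_on_snd Ck_on_id DP open_UNIV)
  qed
  \<comment> \<open>The linearized equation inherits the constant of \<open>f\<close>: an increment
    of \<open>F\<close> in its last argument is the derivative of \<open>f\<close> in a pure space
    direction.\<close>
  have lipF: "\<exists>K. \<forall>\<beta> s x y. \<bar>s\<bar> \<le> S \<longrightarrow> norm (F (\<beta>, s, x) - F (\<beta>, s, y)) \<le> K * norm (x - y)" for S
  proof -
    obtain K where K: "\<And>\<beta> s x y. \<bar>s\<bar> \<le> S \<Longrightarrow> norm (f (\<beta>, s, x) - f (\<beta>, s, y)) \<le> K * norm (x - y)"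
      using lip by blast
    have "norm (F (\<beta>, s, x) - F (\<beta>, s, y)) \<le> K * norm (x - y)" if "\<bar>s\<bar> \<le> S" for \<beta> s x y
    proof -
      interpret D: bounded_linear "?D (\<beta>, s, X \<beta> s)" using D by (rule has_derivative_bounded_linear)
      have "F (\<beta>, s, x) - F (\<beta>, s, y) = ?D (\<beta>, s, X \<beta> s) (0, 0, x - y)"
        by (simp add: F_def D.diff[symmetric])
      moreover have "norm (?D (\<beta>, s, X \<beta> s) (0, 0, x - y)) \<le> K * norm (x - y)"
      proof (rule norm_directional_derivative_le[OF D])
        fix r :: real assume "r > 0"
        then show "norm (f ((\<beta>, s, X \<beta> s) + r *\<^sub>R (0, 0, x - y)) - f (\<beta>, s, X \<beta> s)) \<le> r * (K * norm (x - y))"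
          using K[OF that, of \<beta> "X \<beta> s + r *\<^sub>R (x - y)" "X \<beta> s"] by (simp add: mult.left_commute)
      qed
      ultimately show ?thesis by simp
    qed
    then show ?thesis by blast
  qed
  have "\<exists>z. z 0 = b \<and> (\<forall>s. (z has_vector_derivative F (\<beta>, s, z s)) (at s))" for \<beta>
  proof -
    have "continuous_on UNIV (\<lambda>(s, x). F (\<beta>, s, x))"
      unfolding split_beta
      by (intro continuous_on_compose2[OF Ck_on_imp_continuous_on[OF CkF]] continuous_intros) auto
    moreover have "\<exists>K. \<forall>s x y. \<bar>s\<bar> \<le> S \<longrightarrow> norm (F (\<beta>, s, x) - F (\<beta>, s, y)) \<le> K * norm (x - y)" for S
      using lipF[of S] by blast
    ultimately show ?thesis using ode_solution_exists[of "\<lambda>s x. F (\<beta>, s, x)" b] by metis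
  qed
  then obtain Z where Z: "\<And>\<beta>. Z \<beta> 0 = b" "\<And>\<beta> s. (Z \<beta> has_vector_derivative F (\<beta>, s, Z \<beta> s)) (at s)"
    by metis
  have CkZ: "Ck_on k UNIV (\<lambda>p. Z (fst p) (snd p))"
    by (rule Suc.IH[OF CkF lipF Z(2), of b 0]) (simp add: Z)
  have Z_der: "((\<lambda>\<beta>. X \<beta> s) has_vector_derivative Z \<beta>0 s) (at \<beta>0)" for \<beta>0 s
    by (rule flow_differentiable_parameter[where Z = "Z \<beta>0", OF C1 lip X init])
      (use Z in \<open>simp_all add: F_def\<close>)
  have CkfX: "Ck_on k UNIV (\<lambda>p. f (fst p, snd p, X (fst p) (snd p)))"
    by (rule Ck_on_compose[OF open_UNIV open_UNIV Ckf])
      (auto intro!: Ck_on_Pair Ck_on_fst Ck_on_snd Ck_on_id CkX)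
  \<comment> \<open>Both partial derivatives exist, and the one in s, which is \<open>f\<close>
    along the flow, is continuous; this gives the total derivative.\<close>
  have der: "((\<lambda>p. X (fst p) (snd p)) has_derivative
      (\<lambda>h. fst h *\<^sub>R Z (fst p) (snd p) + snd h *\<^sub>R f (fst p, snd p, X (fst p) (snd p)))) (at p)" for p
  proof -
    have "((\<lambda>(\<beta>, s). X \<beta> s) has_derivative
        (\<lambda>(h, k). h *\<^sub>R Z (fst p) (snd p) + blinfun_scaleR_left (f (fst p, snd p, X (fst p) (snd p))) k))
        (at (fst p, snd p) within UNIV \<times> UNIV)"
    proof (rule has_derivative_partialsI[where fy = "\<lambda>\<beta> s. blinfun_scaleR_left (f (\<beta>, s, X \<beta> s))"])
      show "((\<lambda>\<beta>. X \<beta> (snd p)) has_derivative (\<lambda>h. h *\<^sub>R Z (fst p) (snd p))) (at (fst p))"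
        using Z_der by (simp add: has_vector_derivative_def)
      show "(X \<beta> has_derivative blinfun_apply (blinfun_scaleR_left (f (\<beta>, s, X \<beta> s)))) (at s)" for \<beta> s
        using X[of \<beta> s] by (simp add: has_vector_derivative_def)
      have "continuous_on UNIV (\<lambda>p. blinfun_scaleR_left (f (fst p, snd p, X (fst p) (snd p))))"
        by (rule bounded_linear.continuous_on[OF bounded_linear_blinfun_scaleR_left Ck_on_imp_continuous_on[OF CkfX]])
      then show "continuous (at (fst p, snd p) within UNIV \<times> UNIV) (\<lambda>(\<beta>, s). blinfun_scaleR_left (f (\<beta>, s, X \<beta> s)))"
        by (cases p) (simp add: continuous_on_eq_continuous_at split_beta')
    qed auto
    then show ?thesis by (simp add: split_beta')
  qed
  show ?case
    by (rule Ck_on_SucI[OF open_UNIV der]) (intro Ck_on_add Ck_on_scaleR Ck_on_const CkZ CkfX open_UNIV)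
qed

section \<open>Monotone second-order equations\<close>

text \<open>The map sending (\<beta>, s) to (v, s) is a bijection with inverse \<open>g\<close> =
  (a, s), so \<open>g\<close> is differentiable by the inverse function theorem. The derivative of
  \<open>a\<close> is a rational expression in derivatives of \<open>v\<close> at \<open>g\<close>,
  so each order of \<open>a\<close> yields the next.\<close>

lemma Ck_on_parametric_inverse:
  fixes v a :: "real \<times> real \<Rightarrow> real"
  assumes Ck: "\<And>k. Ck_on k UNIV v"
    and nz: "\<And>p. frechet_derivative v (at p) (1, 0) \<noteq> 0"
    and left: "\<And>\<beta> s. a (v (\<beta>, s), s) = \<beta>"
    and right: "\<And>w s. v (a (w, s), s) = w"
  shows "Ck_on k UNIV a"
proof -
  let ?D = "\<lambda>p. frechet_derivative v (at p)"
  define g where "g q = (a q, snd q)" for q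
  have D: "(v has_derivative ?D p) (at p)" for p
    using Ck_on_Suc_imp_has_derivative[OF Ck] by simp
  have split: "?D p h = fst h * ?D p (1, 0) + snd h * ?D p (0, 1)" for p h
  proof -
    interpret D: bounded_linear "?D p" using D by (rule has_derivative_bounded_linear)
    have "?D p h = ?D p (fst h *\<^sub>R (1, 0) + snd h *\<^sub>R (0, 1))" by (cases h) simp
    then show ?thesis by (simp only: D.add D.scaleR real_scaleR_def)
  qed
  \<comment> \<open>Solves the differentiated identity v (a (w, s), s) = w for the derivative of
    \<open>a\<close>.\<close>
  define a' where "a' q h = (fst h - snd h * ?D (g q) (0, 1)) * inverse (?D (g q) (1, 0))" for q h
  have a': "(a has_derivative a' q) (at q)" for q
  proof -
    have "(g has_derivative (\<lambda>h. (a' q h, snd h))) (at ((\<lambda>p. (v p, snd p)) (g q)))"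
    proof (rule has_derivative_inverse_strong[OF open_UNIV,
          where f = "\<lambda>p. (v p, snd p)" and x = "g q" and f' = "\<lambda>h. (?D (g q) h, snd h)"])
      show "continuous_on UNIV (\<lambda>p. (v p, snd p))"
        using Ck_on_imp_continuous_on[OF Ck] by (intro continuous_intros)
      show "((\<lambda>p. (v p, snd p)) has_derivative (\<lambda>h. (?D (g q) h, snd h))) (at (g q))"
        by (intro has_derivative_Pair D bounded_linear_imp_has_derivative bounded_linear_snd)
      have "fst (a' q h, snd h) * ?D (g q) (1, 0) + snd h * ?D (g q) (0, 1) = fst h" for h
        using nz[of "g q"] by (simp add: a'_def mult.assoc)
      then show "(\<lambda>h. (?D (g q) h, snd h)) \<circ> (\<lambda>h. (a' q h, snd h)) = id"
        by (auto simp: fun_eq_iff split[of _ "(a' q _, _)"])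
    qed (auto simp: g_def left)
    moreover have "(\<lambda>p. (v p, snd p)) (g q) = q" by (cases q) (simp add: g_def right)
    ultimately have "(g has_derivative (\<lambda>h. (a' q h, snd h))) (at q)" by simp
    from bounded_linear.has_derivative[OF bounded_linear_fst this] show ?thesis by (simp add: g_def)
  qed
  show ?thesis
  proof (induction k)
    case 0
    show ?case
      using a' by (auto intro!: continuous_at_imp_continuous_on has_derivative_continuous)
  next
    case (Suc k)
    have "Ck_on k UNIV g" unfolding g_def by (intro Ck_on_Pair Suc.IH Ck_on_snd Ck_on_id open_UNIV)
    then have Dg: "Ck_on k UNIV (\<lambda>q. ?D (g q) b)" if "b \<in> Basis" for b
      by (rule Ck_on_compose[OF open_UNIV open_UNIV, where g = "\<lambda>p. ?D p b", rotated])
        (use Ck[of "Suc k"] that in auto)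
    show ?case
      by (rule Ck_on_SucI[OF open_UNIV a'], unfold a'_def)
        (auto intro!: Ck_on_mult Ck_on_diff Ck_on_const Ck_on_inverse Dg nz simp: Basis_prod_def)
  qed
qed

text \<open>The sign of \<open>w2\<close> is known only where \<open>w\<close> is nonnegative. Two
  mean value steps give the bound under that proviso, and looking at the first time with
  \<open>w\<close> at most 0 removes it.\<close>

lemma convex_where_nonneg_imp_ge_initial:
  fixes w w1 w2 :: "real \<Rightarrow> real"
  assumes w: "\<And>s. (w has_real_derivative w1 s) (at s)"
    and w1: "\<And>s. (w1 has_real_derivative w2 s) (at s)"
    and w2: "\<And>s. w s \<ge> 0 \<Longrightarrow> w2 s \<ge> 0"
    and "w 0 > 0" "w1 0 \<ge> 0" "s \<ge> 0"
  shows "w s \<ge> w 0"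
proof -
  \<comment> \<open>Nonnegativity is asked only strictly before \<open>s\<close>, so that the claim
    can be used at the first bad time itself.\<close>
  have key: "w s \<ge> w 0" if "s \<ge> 0" "\<And>t. 0 \<le> t \<Longrightarrow> t < s \<Longrightarrow> w t \<ge> 0" for s
  proof (rule ccontr)
    assume "\<not> w s \<ge> w 0"
    with that have "s > 0" by (cases "s = 0") auto
    obtain x where x: "0 < x" "x < s" "w s - w 0 = (s - 0) * w1 x"
      using MVT2[OF \<open>s > 0\<close>, of w w1] w by auto
    with \<open>\<not> w s \<ge> w 0\<close> have "s * w1 x < 0" by simp
    then have "w1 x < 0" using \<open>s > 0\<close> by (simp add: mult_less_0_iff)
    obtain y where y: "0 < y" "y < x" "w1 x - w1 0 = (x - 0) * w2 y"
      using MVT2[OF \<open>0 < x\<close>, of w1 w2] w1 by auto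
    with \<open>w1 x < 0\<close> \<open>w1 0 \<ge> 0\<close> have "x * w2 y < 0" by simp
    then have "w2 y < 0" using \<open>0 < x\<close> by (simp add: mult_less_0_iff)
    then show False using w2[of y] that(2)[of y] x y by simp
  qed
  have "w t \<ge> 0" if "t \<ge> 0" for t
  proof (rule ccontr)
    assume neg: "\<not> w t \<ge> 0"
    \<comment> \<open>The condition is at most 0 rather than negative: this makes \<open>T\<close>
      compact, so that it has a first point.\<close>
    define T where "T = {0..t} \<inter> w -` {..0}"
    have "continuous_on UNIV w" using w by (intro continuous_at_imp_continuous_on) (auto intro: DERIV_isCont)
    from closed_vimage[OF closed_atMost this, of 0] have "compact T"
      unfolding T_def by (rule compact_Int_closed[OF compact_Icc])
    moreover have "T \<noteq> {}" using neg that by (auto simp: T_def)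
    ultimately obtain x where x: "x \<in> T" "\<And>y. y \<in> T \<Longrightarrow> x \<le> y" using compact_attains_inf[of T] by auto
    have "w x \<ge> w 0"
    proof (rule key)
      show "x \<ge> 0" using x by (simp add: T_def)
      fix y assume y: "0 \<le> y" "y < x"
      then have "y \<notin> T" using x(2)[of y] by auto
      then show "w y \<ge> 0" using y x(1) by (auto simp: T_def)
    qed
    then show False using x \<open>w 0 > 0\<close> by (simp add: T_def)
  qed
  with key \<open>s \<ge> 0\<close> show ?thesis by blast
qed

section \<open>Second-order equations as first-order systems\<close>

lemma second_order_system_lipschitz:
  fixes G :: "real \<Rightarrow> real \<Rightarrow> real" and x y :: "real \<times> real"
  assumes "\<And>v w. \<bar>G v s - G w s\<bar> \<le> K * \<bar>v - w\<bar>"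
  shows "norm ((snd x, G (fst x) s) - (snd y, G (fst y) s)) \<le> (1 + \<bar>K\<bar>) * norm (x - y)"
proof -
  have "norm ((snd x, G (fst x) s) - (snd y, G (fst y) s)) \<le> \<bar>snd x - snd y\<bar> + \<bar>G (fst x) s - G (fst y) s\<bar>"
    using norm_Pair_le[of "snd x - snd y" "G (fst x) s - G (fst y) s"] by simp
  moreover have "\<bar>snd x - snd y\<bar> \<le> norm (x - y)" using norm_snd_le[of "snd (x - y)" "fst (x - y)"] unfolding prod.collapse by simp
  moreover have "\<bar>G (fst x) s - G (fst y) s\<bar> \<le> \<bar>K\<bar> * norm (x - y)"
  proof -
    have "K * \<bar>fst x - fst y\<bar> \<le> \<bar>K\<bar> * norm (x - y)"
      using norm_fst_le[of "fst (x - y)" "snd (x - y)"] unfolding prod.collapse by (intro mult_mono) auto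
    then show ?thesis using assms[of "fst x" "fst y"] by linarith
  qed
  ultimately show ?thesis by (simp add: algebra_simps)
qed

text \<open>The equation is required only between \<open>a\<close> and \<open>b\<close>, because one
  of the competitors is the explicit exponential, known to be a solution for s <= 0.\<close>

lemma second_order_solution_unique:
  fixes G :: "real \<Rightarrow> real \<Rightarrow> real"
  assumes lip: "\<And>S. \<exists>K. \<forall>s v w. \<bar>s\<bar> \<le> S \<longrightarrow> \<bar>G v s - G w s\<bar> \<le> K * \<bar>v - w\<bar>"
    and v: "\<And>s. s \<in> closed_segment a b \<Longrightarrow> (v has_real_derivative v1 s) (at s)"
      "\<And>s. s \<in> closed_segment a b \<Longrightarrow> (v1 has_real_derivative G (v s) s) (at s)"
    and w: "\<And>s. s \<in> closed_segment a b \<Longrightarrow> (w has_real_derivative w1 s) (at s)"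
      "\<And>s. s \<in> closed_segment a b \<Longrightarrow> (w1 has_real_derivative G (w s) s) (at s)"
    and "v a = w a" "v1 a = w1 a"
  shows "v b = w b"
proof -
  obtain K where K: "\<And>s v w. \<bar>s\<bar> \<le> \<bar>a\<bar> + \<bar>b\<bar> \<Longrightarrow> \<bar>G v s - G w s\<bar> \<le> K * \<bar>v - w\<bar>"
    using lip by blast
  have "(v b, v1 b) = (w b, w1 b)"
  proof (rule ode_solution_unique[where f = "\<lambda>s x. (snd x, G (fst x) s)" and x = "\<lambda>s. (v s, v1 s)" and y = "\<lambda>s. (w s, w1 s)"])
    fix s :: real and x y :: "real \<times> real" assume "s \<in> closed_segment a b"
    then have "\<bar>s\<bar> \<le> \<bar>a\<bar> + \<bar>b\<bar>" by (auto simp: closed_segment_eq_real_ivl split: if_splits)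
    from second_order_system_lipschitz[where G = G, OF K[OF this]]
    show "norm ((snd x, G (fst x) s) - (snd y, G (fst y) s)) \<le> (1 + \<bar>K\<bar>) * norm (x - y)" .
  qed (use assms in \<open>auto intro!: has_vector_derivative_Pair simp flip: has_real_derivative_iff_has_vector_derivative\<close>)
  then show ?thesis by simp
qed

text \<open>Per unit of \<beta>, the gap is exactly exp (c s) for s <= 0 and never falls below its
  initial value 1 for s >= 0; the minimum joins both cases in one positive factor.\<close>

lemma monotone_second_order_family:
  fixes G :: "real \<Rightarrow> real \<Rightarrow> real"
  assumes smooth: "\<And>k. Ck_on k UNIV (\<lambda>p. G (fst p) (snd p))"
    and lip: "\<And>S. \<exists>K. \<forall>s v w. \<bar>s\<bar> \<le> S \<longrightarrow> \<bar>G v s - G w s\<bar> \<le> K * \<bar>v - w\<bar>"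
    and mono: "\<And>s. mono (\<lambda>v. G v s)"
    and lin: "\<forall>s\<le>0. \<forall>v. G v s = c\<^sup>2 * v"
    and "c \<ge> 0"
  shows "\<exists>v v1. (\<forall>\<beta> s. (v \<beta> has_real_derivative v1 \<beta> s) (at s)) \<and>
    (\<forall>\<beta> s. (v1 \<beta> has_real_derivative G (v \<beta> s) s) (at s)) \<and>
    (\<forall>\<beta> s. s \<le> 0 \<longrightarrow> v \<beta> s = \<beta> * exp (c * s)) \<and>
    (\<forall>k. Ck_on k UNIV (\<lambda>p. v (fst p) (snd p))) \<and>
    (\<forall>\<beta>1 \<beta>2 s. \<beta>1 \<le> \<beta>2 \<longrightarrow> min 1 (exp (c * s)) * (\<beta>2 - \<beta>1) \<le> v \<beta>2 s - v \<beta>1 s)"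
proof -
  define f :: "real \<times> real \<times> real \<times> real \<Rightarrow> real \<times> real"
    where "f = (\<lambda>p. (snd (snd (snd p)), G (fst (snd (snd p))) (fst (snd p))))"
  have Ckf: "Ck_on k UNIV f" for k
    unfolding f_def
    by (intro Ck_on_Pair Ck_on_fst Ck_on_snd Ck_on_id open_UNIV
        Ck_on_compose[OF open_UNIV open_UNIV smooth, where f = "\<lambda>p. (fst (snd (snd p)), fst (snd p))", simplified])
  have lipf: "\<exists>K. \<forall>\<beta> s x y. \<bar>s\<bar> \<le> S \<longrightarrow> norm (f (\<beta>, s, x) - f (\<beta>, s, y)) \<le> K * norm (x - y)" for S
  proof -
    obtain K where K: "\<And>s v w. \<bar>s\<bar> \<le> S \<Longrightarrow> \<bar>G v s - G w s\<bar> \<le> K * \<bar>v - w\<bar>" using lip by blast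
    have "norm (f (\<beta>, s, x) - f (\<beta>, s, y)) \<le> (1 + \<bar>K\<bar>) * norm (x - y)" if "\<bar>s\<bar> \<le> S" for \<beta> s x y
      using second_order_system_lipschitz[where G = G, OF K[OF that], of x y] unfolding f_def by simp
    then show ?thesis by blast
  qed
  \<comment> \<open>(1, c) are the value and slope of exp (c s) at s = 0, the mode with the
    prescribed behaviour at large r.\<close>
  have "\<exists>x. x 0 = \<beta> *\<^sub>R (1, c) \<and> (\<forall>s. (x has_vector_derivative f (\<beta>, s, x s)) (at s))" for \<beta>
  proof -
    have "continuous_on UNIV (\<lambda>(s, x). f (\<beta>, s, x))"
      unfolding split_beta
      by (intro continuous_on_compose2[OF Ck_on_imp_continuous_on[OF Ckf]] continuous_intros) auto
    moreover have "\<exists>K. \<forall>s x y. \<bar>s\<bar> \<le> S \<longrightarrow> norm (f (\<beta>, s, x) - f (\<beta>, s, y)) \<le> K * norm (x - y)" for S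
      using lipf[of S] by blast
    ultimately show ?thesis using ode_solution_exists[of "\<lambda>s x. f (\<beta>, s, x)" "\<beta> *\<^sub>R (1, c)"] by metis
  qed
  then obtain X where X0: "\<And>\<beta>. X \<beta> 0 = \<beta> *\<^sub>R (1, c)"
    and X: "\<And>\<beta> s. (X \<beta> has_vector_derivative f (\<beta>, s, X \<beta> s)) (at s)" by metis
  define v v1 where "v \<beta> s = fst (X \<beta> s)" and "v1 \<beta> s = snd (X \<beta> s)" for \<beta> s
  have v: "(v \<beta> has_real_derivative v1 \<beta> s) (at s)" for \<beta> s
    unfolding v_def v1_def has_real_derivative_iff_has_vector_derivative
    using bounded_linear.has_vector_derivative[OF bounded_linear_fst X[of \<beta> s]] by (simp add: f_def)
  have v1: "(v1 \<beta> has_real_derivative G (v \<beta> s) s) (at s)" for \<beta> s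
    unfolding v_def v1_def has_real_derivative_iff_has_vector_derivative
    using bounded_linear.has_vector_derivative[OF bounded_linear_snd X[of \<beta> s]] by (simp add: f_def)
  have init: "v \<beta> 0 = \<beta>" "v1 \<beta> 0 = c * \<beta>" for \<beta> by (simp_all add: v_def v1_def X0)
  have nonpos: "v \<beta> s = \<beta> * exp (c * s)" if "s \<le> 0" for \<beta> s
  proof (rule second_order_solution_unique[OF lip v v1, of 0 _ _ "\<lambda>s. \<beta> * (c * exp (c * s))"])
    fix t assume "t \<in> closed_segment 0 s"
    then have "t \<le> 0" using that by (auto simp: closed_segment_eq_real_ivl split: if_splits)
    show "((\<lambda>s. \<beta> * exp (c * s)) has_real_derivative \<beta> * (c * exp (c * t))) (at t)"
      by (auto intro!: derivative_eq_intros)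
    show "((\<lambda>s. \<beta> * (c * exp (c * s))) has_real_derivative G (\<beta> * exp (c * t)) t) (at t)"
      using lin \<open>t \<le> 0\<close> by (auto intro!: derivative_eq_intros simp: power2_eq_square)
  qed (simp_all add: init)
  have CkX: "Ck_on k UNIV (\<lambda>p. X (fst p) (snd p))" for k
    using flow_Ck[OF Ckf lipf X, of 0 "(1, c)"] X0 by simp
  have "Ck_on k UNIV (\<lambda>p. v (fst p) (snd p))" for k
    unfolding v_def by (intro Ck_on_fst CkX open_UNIV)
  moreover have "min 1 (exp (c * s)) * (\<beta>2 - \<beta>1) \<le> v \<beta>2 s - v \<beta>1 s" if "\<beta>1 \<le> \<beta>2" for \<beta>1 \<beta>2 s
  proof (cases "s \<le> 0")
    case True
    have "min 1 (exp (c * s)) * (\<beta>2 - \<beta>1) \<le> exp (c * s) * (\<beta>2 - \<beta>1)"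
      using that by (intro mult_right_mono) auto
    then show ?thesis using True by (simp add: nonpos algebra_simps)
  next
    case False
    have "\<beta>2 - \<beta>1 \<le> v \<beta>2 s - v \<beta>1 s"
    \<comment> \<open>The convexity lemma wants a strictly positive initial gap, so equal parameters
      are set apart.\<close>
    proof (cases "\<beta>1 = \<beta>2")
      case neq: False
      have "v \<beta>2 0 - v \<beta>1 0 \<le> v \<beta>2 s - v \<beta>1 s"
      proof (rule convex_where_nonneg_imp_ge_initial[where w = "\<lambda>s. v \<beta>2 s - v \<beta>1 s" and ?w1.0 = "\<lambda>s. v1 \<beta>2 s - v1 \<beta>1 s"
            and ?w2.0 = "\<lambda>s. G (v \<beta>2 s) s - G (v \<beta>1 s) s"])
        show "v1 \<beta>2 0 - v1 \<beta>1 0 \<ge> 0" using that \<open>c \<ge> 0\<close> by (simp add: init mult_left_mono)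
        show "G (v \<beta>2 s) s - G (v \<beta>1 s) s \<ge> 0" if "v \<beta>2 s - v \<beta>1 s \<ge> 0" for s
          using monoD[OF mono] that by simp
      qed (use that neq False in \<open>auto intro!: DERIV_diff v v1 simp: init\<close>)
      then show ?thesis by (simp add: init)
    qed simp
    moreover have "min 1 (exp (c * s)) * (\<beta>2 - \<beta>1) \<le> 1 * (\<beta>2 - \<beta>1)"
      using that by (intro mult_right_mono) auto
    ultimately show ?thesis by simp
  qed
  ultimately show ?thesis using v v1 nonpos by blast
qed

section \<open>Rescaling of the radial equation\<close>

text \<open>The function G of the rescaled equation, with \<open>g\<close> in the role of V_u. It is
  a parameter because the same expression is used with \<open>deriv\<close> of V and with a smooth
  function on the product space, which agree at positive radii.\<close>

definition rescaled_force ::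
  "real \<Rightarrow> real \<Rightarrow> real \<Rightarrow> (real \<Rightarrow> real \<Rightarrow> real) \<Rightarrow> real \<Rightarrow> real \<Rightarrow> real" where
  "rescaled_force c A R g v s =
     c\<^sup>2 * v - exp (- (c * s)) * (R * exp (- s))\<^sup>2 * g (A + exp (c * s) * v) (R * exp (- s))"

text \<open>Because n - 1 = 2 c + 1, differentiating twice in s produces r^2 times the radial
  operator with the right first-order coefficient, and the only other term is c^2 v.\<close>

lemma radial_solution_rescale:
  assumes n: "real n = 2 * c + 2" and "R > 0" and sol: "radial_solution n V u"
  obtains v1 where
    "\<And>s. ((\<lambda>s. exp (- (c * s)) * (u (R * exp (- s)) - A)) has_real_derivative v1 s) (at s)"
    "\<And>s. (v1 has_real_derivative
      rescaled_force c A R (\<lambda>u r. deriv (\<lambda>w. V w r) u) (exp (- (c * s)) * (u (R * exp (- s)) - A)) s) (at s)"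
proof -
  obtain u1 u2 where u: "\<And>r. r > 0 \<Longrightarrow> (u has_real_derivative u1 r) (at r)"
      "\<And>r. r > 0 \<Longrightarrow> (u1 has_real_derivative u2 r) (at r)"
      "\<And>r. r > 0 \<Longrightarrow> u2 r + (real n - 1) / r * u1 r + deriv (\<lambda>w. V w r) (u r) = 0"
    using sol unfolding radial_solution_def by blast
  define \<rho> where "\<rho> s = R * exp (- s)" for s
  have pos: "\<rho> s > 0" for s using \<open>R > 0\<close> by (simp add: \<rho>_def)
  have \<rho>': "(\<rho> has_real_derivative - \<rho> s) (at s)" for s
    unfolding \<rho>_def by (auto intro!: derivative_eq_intros)
  have du: "((\<lambda>s. u (\<rho> s)) has_real_derivative u1 (\<rho> s) * - \<rho> s) (at s)" for s
    by (rule DERIV_chain2[OF u(1)[OF pos] \<rho>'])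
  have du1: "((\<lambda>s. u1 (\<rho> s)) has_real_derivative u2 (\<rho> s) * - \<rho> s) (at s)" for s
    by (rule DERIV_chain2[OF u(2)[OF pos] \<rho>'])
  let ?v1 = "\<lambda>s. exp (- (c * s)) * (- c * (u (\<rho> s) - A) - \<rho> s * u1 (\<rho> s))"
  have "((\<lambda>s. exp (- (c * s)) * (u (\<rho> s) - A)) has_real_derivative ?v1 s) (at s)" for s
    by (rule derivative_eq_intros du refl | simp add: algebra_simps)+
  moreover have "(?v1 has_real_derivative
      rescaled_force c A R (\<lambda>u r. deriv (\<lambda>w. V w r) u) (exp (- (c * s)) * (u (\<rho> s) - A)) s) (at s)" for s
  proof -
    have der: "(?v1 has_real_derivative
        exp (- (c * s)) * (c\<^sup>2 * (u (\<rho> s) - A) + (2 * c + 1) * \<rho> s * u1 (\<rho> s) + (\<rho> s)\<^sup>2 * u2 (\<rho> s))) (at s)"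
      by (rule derivative_eq_intros du du1 \<rho>' refl | simp add: algebra_simps power2_eq_square)+
    \<comment> \<open>The radial equation, multiplied by \<rho>^2.\<close>
    have e1: "(2 * c + 1) * \<rho> s * u1 (\<rho> s) + (\<rho> s)\<^sup>2 * u2 (\<rho> s) = - (\<rho> s)\<^sup>2 * deriv (\<lambda>w. V w (\<rho> s)) (u (\<rho> s))"
    proof -
      have u2_eq: "u2 (\<rho> s) = - ((2 * c + 1) / \<rho> s * u1 (\<rho> s)) - deriv (\<lambda>w. V w (\<rho> s)) (u (\<rho> s))"
        using u(3)[OF pos, of s] n by (simp add: algebra_simps)
      show ?thesis unfolding u2_eq using pos[of s] by (simp add: field_simps power2_eq_square)
    qed
    have e2: "A + exp (c * s) * (exp (- (c * s)) * (u (\<rho> s) - A)) = u (\<rho> s)"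
      by (simp add: exp_minus_inverse flip: mult.assoc)
    have "exp (- (c * s)) * (c\<^sup>2 * (u (\<rho> s) - A) + (2 * c + 1) * \<rho> s * u1 (\<rho> s) + (\<rho> s)\<^sup>2 * u2 (\<rho> s)) =
        rescaled_force c A R (\<lambda>u r. deriv (\<lambda>w. V w r) u) (exp (- (c * s)) * (u (\<rho> s) - A)) s"
      unfolding rescaled_force_def \<rho>_def[symmetric] e2 add.assoc e1 by (simp add: algebra_simps)
    with der show ?thesis by simp
  qed
  ultimately show thesis using that[of ?v1] unfolding \<rho>_def by blast
qed

lemma radial_solution_unrescale:
  assumes n: "real n = 2 * c + 2" and "R > 0"
    and v: "\<And>s. (v has_real_derivative v1 s) (at s)"
    and v1: "\<And>s. (v1 has_real_derivative rescaled_force c A R (\<lambda>u r. deriv (\<lambda>w. V w r) u) (v s) s) (at s)"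
    and u: "\<And>r. r > 0 \<Longrightarrow> u r = A + exp (c * (ln R - ln r)) * v (ln R - ln r)"
  shows "radial_solution n V u"
proof -
  define \<sigma> where "\<sigma> r = ln R - ln r" for r
  define v2 where "v2 s = rescaled_force c A R (\<lambda>u r. deriv (\<lambda>w. V w r) u) (v s) s" for s
  define u1 where "u1 r = - exp (c * \<sigma> r) * (c * v (\<sigma> r) + v1 (\<sigma> r)) / r" for r
  define u2 where "u2 r = exp (c * \<sigma> r) * ((1 + c) * (c * v (\<sigma> r) + v1 (\<sigma> r)) + c * v1 (\<sigma> r) + v2 (\<sigma> r)) / r\<^sup>2" for r
  have \<sigma>': "(\<sigma> has_real_derivative - (1 / r)) (at r)" if "r > 0" for r
    unfolding \<sigma>_def using that by (auto intro!: derivative_eq_intros)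
  have dv: "((\<lambda>r. v (\<sigma> r)) has_real_derivative v1 (\<sigma> r) * - (1 / r)) (at r)" if "r > 0" for r
    by (rule DERIV_chain2[OF v \<sigma>'[OF that]])
  have dv1: "((\<lambda>r. v1 (\<sigma> r)) has_real_derivative v2 (\<sigma> r) * - (1 / r)) (at r)" if "r > 0" for r
    unfolding v2_def by (rule DERIV_chain2[OF v1 \<sigma>'[OF that]])
  have "(u has_real_derivative u1 r) (at r)" if "r > 0" for r
  proof (rule has_field_derivative_transform_within_open)
    show "((\<lambda>r. A + exp (c * \<sigma> r) * v (\<sigma> r)) has_real_derivative u1 r) (at r)"
      unfolding u1_def
      by (rule derivative_eq_intros dv \<sigma>' that refl | (use that in \<open>simp add: field_simps\<close>))+
  qed (use that u in \<open>auto simp: \<sigma>_def intro: open_greaterThan[of 0]\<close>)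
  moreover have "(u1 has_real_derivative u2 r) (at r)" if "r > 0" for r
    unfolding u1_def u2_def
    by (rule derivative_eq_intros dv dv1 \<sigma>' that refl | (use that in \<open>simp add: field_simps power2_eq_square\<close>))+
  moreover have "u2 r + (real n - 1) / r * u1 r + deriv (\<lambda>w. V w r) (u r) = 0" if "r > 0" for r
  proof -
    have \<rho>: "R * exp (- \<sigma> r) = r" using that \<open>R > 0\<close> by (simp add: \<sigma>_def exp_diff)
    have v2_eq: "v2 (\<sigma> r) = c\<^sup>2 * v (\<sigma> r) - exp (- (c * \<sigma> r)) * r\<^sup>2 * deriv (\<lambda>w. V w r) (u r)"
      using u[OF that] by (simp add: v2_def rescaled_force_def \<rho> \<sigma>_def[symmetric])
    have "exp (c * \<sigma> r) * v2 (\<sigma> r) = exp (c * \<sigma> r) * c\<^sup>2 * v (\<sigma> r) -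
        (exp (c * \<sigma> r) * exp (- (c * \<sigma> r))) * (r\<^sup>2 * deriv (\<lambda>w. V w r) (u r))"
      unfolding v2_eq by (simp only: algebra_simps)
    then have v2: "exp (c * \<sigma> r) * v2 (\<sigma> r) = exp (c * \<sigma> r) * c\<^sup>2 * v (\<sigma> r) - r\<^sup>2 * deriv (\<lambda>w. V w r) (u r)"
      by (simp flip: exp_add)
    have "r\<^sup>2 * (u2 r + (real n - 1) / r * u1 r + deriv (\<lambda>w. V w r) (u r)) =
        exp (c * \<sigma> r) * v2 (\<sigma> r) - exp (c * \<sigma> r) * c\<^sup>2 * v (\<sigma> r) + r\<^sup>2 * deriv (\<lambda>w. V w r) (u r)"
      using that unfolding u1_def u2_def n by (simp add: field_simps power2_eq_square)
    then have "r\<^sup>2 * (u2 r + (real n - 1) / r * u1 r + deriv (\<lambda>w. V w r) (u r)) = 0"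
      by (simp add: v2)
    then show ?thesis using that by simp
  qed
  ultimately show ?thesis unfolding radial_solution_def by blast
qed

text \<open>One exponential comes from u = A + exp (c s) v, the other from v = \<beta> exp (c s);
  together they form the harmonic profile r^-(n - 2), normalized at R.\<close>

lemma exp_mult_ln_diff:
  assumes "R > 0" "r > 0" "real m = 2 * c"
  shows "exp (c * (ln R - ln r)) * exp (c * (ln R - ln r)) = R ^ m / r ^ m"
proof -
  have "exp (c * (ln R - ln r)) * exp (c * (ln R - ln r)) = exp (real m * (ln R - ln r))"
    by (simp add: assms(3) flip: exp_add)
  also have "\<dots> = exp (ln R - ln r) ^ m" by (rule exp_of_nat_mult)
  also have "\<dots> = R ^ m / r ^ m" using assms(1,2) by (simp add: exp_diff power_divide)
  finally show ?thesis .
qed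

text \<open>Far out, an element of \<open>N_set\<close> is explicit, so its rescaling coincides
  there with a member of the family, and uniqueness spreads this to all s. Equality is restricted to
  r > 0 because \<open>N_set\<close> leaves the other values of \<open>u\<close> free.\<close>

lemma N_set_iff_family:
  assumes n: "n \<ge> 2" "real n = 2 * c + 2" and "R > 0"
    and lip: "\<And>S. \<exists>K. \<forall>s v w. \<bar>s\<bar> \<le> S \<longrightarrow>
      \<bar>rescaled_force c A R (\<lambda>u r. deriv (\<lambda>w. V w r) u) v s - rescaled_force c A R (\<lambda>u r. deriv (\<lambda>w. V w r) u) w s\<bar> \<le> K * \<bar>v - w\<bar>"
    and v: "\<And>\<beta> s. (v \<beta> has_real_derivative v1 \<beta> s) (at s)"
    and v1: "\<And>\<beta> s. (v1 \<beta> has_real_derivative rescaled_force c A R (\<lambda>u r. deriv (\<lambda>w. V w r) u) (v \<beta> s) s) (at s)"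
    and nonpos: "\<And>\<beta> s. s \<le> 0 \<Longrightarrow> v \<beta> s = \<beta> * exp (c * s)"
  shows "u \<in> N_set n V A \<longleftrightarrow> (\<exists>\<beta>. \<forall>r>0. u r = A + exp (c * (ln R - ln r)) * v \<beta> (ln R - ln r))"
proof
  have m: "real (n - 2) = 2 * c" using n by simp
  assume "u \<in> N_set n V A"
  then obtain \<alpha> where sol: "radial_solution n V u" and ev: "\<forall>\<^sub>F r in at_top. u r = \<alpha> / r ^ (n - 2) + A"
    unfolding N_set_def by blast
  obtain M where M: "\<And>r. r \<ge> M \<Longrightarrow> u r = \<alpha> / r ^ (n - 2) + A" using ev unfolding eventually_at_top_linorder by blast
  \<comment> \<open>Being at least R forces s0 <= 0, where the family is explicit.\<close>
  define M' where "M' = max M (max R 1)"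
  define \<beta> where "\<beta> = \<alpha> / R ^ (n - 2)"
  let ?v = "\<lambda>s. exp (- (c * s)) * (u (R * exp (- s)) - A)"
  obtain w1 where w1: "\<And>s. (?v has_real_derivative w1 s) (at s)"
      "\<And>s. (w1 has_real_derivative rescaled_force c A R (\<lambda>u r. deriv (\<lambda>w. V w r) u) (?v s) s) (at s)"
    by (rule radial_solution_rescale[OF n(2) \<open>R > 0\<close> sol, of A]) blast
  define s0 where "s0 = ln R - ln M'"
  have "M' > 0" by (simp add: M'_def)
  have "s0 \<le> 0" using \<open>R > 0\<close> by (simp add: s0_def M'_def)
  have far: "?v s = v \<beta> s" if "s \<le> s0" for s
  proof -
    have "R * exp (- s) \<ge> R * exp (- s0)" using that \<open>R > 0\<close> by simp
    also have "R * exp (- s0) = M'" using \<open>R > 0\<close> \<open>M' > 0\<close> by (simp add: s0_def exp_diff)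
    finally have "u (R * exp (- s)) - A = \<alpha> / (R * exp (- s)) ^ (n - 2)" by (simp add: M'_def M)
    also have "\<dots> = \<beta> * exp (real (n - 2) * s)"
      using exp_of_nat_mult[of "n - 2" s] \<open>R > 0\<close>
      by (simp add: \<beta>_def power_mult_distrib exp_minus divide_inverse power_inverse)
    finally show ?thesis using that \<open>s0 \<le> 0\<close> nonpos[of s \<beta>] unfolding m
      by (simp add: exp_minus field_simps flip: exp_add)
  qed
  have "?v s = v \<beta> s" for s
  proof (rule second_order_solution_unique[OF lip w1 v v1])
    \<comment> \<open>A point strictly before s0: agreement holds in a neighbourhood of it, so the
      first derivatives match as well.\<close>
    show "?v (s0 - 1) = v \<beta> (s0 - 1)" by (rule far) simp
    have "(v \<beta> has_real_derivative w1 (s0 - 1)) (at (s0 - 1))"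
      by (rule has_field_derivative_transform_within_open[OF w1(1) open_lessThan[of s0]]) (auto simp: far)
    then show "w1 (s0 - 1) = v1 \<beta> (s0 - 1)" using v by (rule DERIV_unique)
  qed
  then have "u r = A + exp (c * (ln R - ln r)) * v \<beta> (ln R - ln r)" if "r > 0" for r
  proof -
    have "R * exp (- (ln R - ln r)) = r" using that \<open>R > 0\<close> by (simp add: exp_diff)
    then have "v \<beta> (ln R - ln r) = exp (- (c * (ln R - ln r))) * (u r - A)"
      using \<open>\<And>s. ?v s = v \<beta> s\<close>[of "ln R - ln r"] by simp
    then show ?thesis by (simp add: exp_minus_inverse flip: mult.assoc)
  qed
  then show "\<exists>\<beta>. \<forall>r>0. u r = A + exp (c * (ln R - ln r)) * v \<beta> (ln R - ln r)" by blast
next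
  have m: "real (n - 2) = 2 * c" using n by simp
  assume "\<exists>\<beta>. \<forall>r>0. u r = A + exp (c * (ln R - ln r)) * v \<beta> (ln R - ln r)"
  then obtain \<beta> where u: "\<And>r. r > 0 \<Longrightarrow> u r = A + exp (c * (ln R - ln r)) * v \<beta> (ln R - ln r)" by blast
  have "radial_solution n V u" by (rule radial_solution_unrescale[OF n(2) \<open>R > 0\<close> v v1 u])
  moreover have "u r = \<beta> * R ^ (n - 2) / r ^ (n - 2) + A" if "r \<ge> R" for r
    using u[of r] nonpos[of "ln R - ln r" \<beta>] exp_mult_ln_diff[OF \<open>R > 0\<close> _ m, of r] that \<open>R > 0\<close>
    by (simp add: mult.left_commute)
  ultimately show "u \<in> N_set n V A"
    unfolding N_set_def eventually_at_top_linorder by blast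
qed

section \<open>The foliation\<close>

lemma Ck_on_rescaled_force:
  fixes P :: "real \<times> 'b::euclidean_space \<Rightarrow> real"
  assumes "\<And>k. Ck_on k UNIV P"
  shows "Ck_on k UNIV (\<lambda>p. rescaled_force c A R (\<lambda>u r. P (u, r *\<^sub>R e)) (fst p) (snd p))"
proof -
  have neg: "Ck_on k UNIV (\<lambda>p::real \<times> real. - snd p)"
    by (rule Ck_on_bounded_linear[OF bounded_linear_minus[OF bounded_linear_snd] open_UNIV])
  have "Ck_on k UNIV (\<lambda>p. c * c * fst p - exp (c * - snd p) * (R * exp (- snd p)) * (R * exp (- snd p)) *
      P (A + exp (c * snd p) * fst p, (R * exp (- snd p)) *\<^sub>R e))"
    by (intro Ck_on_diff Ck_on_mult Ck_on_const Ck_on_fst Ck_on_snd Ck_on_id Ck_on_exp neg open_UNIV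
        Ck_on_compose[OF open_UNIV open_UNIV assms, where f = "\<lambda>p. (A + exp (c * snd p) * fst p, (R * exp (- snd p)) *\<^sub>R e)"]
        Ck_on_Pair Ck_on_add Ck_on_scaleR subset_UNIV)
  then show ?thesis by (simp add: rescaled_force_def power2_eq_square mult.assoc)
qed

text \<open>The inner factor exp (c s) from the chain rule cancels the outer weight exp (- c s), so
  the slope involves only r^2 g'.\<close>

lemma rescaled_force_has_derivative:
  assumes "\<And>u r. r > 0 \<Longrightarrow> ((\<lambda>w. g w r) has_real_derivative g' u r) (at u)" "R > 0"
  shows "((\<lambda>v. rescaled_force c A R g v s) has_real_derivative
    c\<^sup>2 - (R * exp (- s))\<^sup>2 * g' (A + exp (c * s) * v) (R * exp (- s))) (at v)"
proof -
  have "R * exp (- s) > 0" using \<open>R > 0\<close> by simp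
  note g = DERIV_chain2[OF assms(1)[OF this]]
  have "((\<lambda>v. A + exp (c * s) * v) has_real_derivative exp (c * s)) (at v)"
    by (auto intro!: derivative_eq_intros)
  from g[OF this]
  have "((\<lambda>v. rescaled_force c A R g v s) has_real_derivative
    c\<^sup>2 - exp (- (c * s)) * (R * exp (- s))\<^sup>2 * (g' (A + exp (c * s) * v) (R * exp (- s)) * exp (c * s))) (at v)"
    unfolding rescaled_force_def by (auto intro!: derivative_eq_intros)
  moreover have "exp (- (c * s)) * (R * exp (- s))\<^sup>2 * (g' (A + exp (c * s) * v) (R * exp (- s)) * exp (c * s)) =
      (exp (c * s) * exp (- (c * s))) * ((R * exp (- s))\<^sup>2 * g' (A + exp (c * s) * v) (R * exp (- s)))"
    by (simp only: mult_ac)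
  ultimately show ?thesis by (simp add: exp_minus_inverse)
qed

text \<open>The factor r^2 cancels the singular bound 1 / (4 r^2) exactly, so the slope is at least
  c^2 - 1 / 4.\<close>

lemma rescaled_force_mono:
  assumes "\<And>u r. r > 0 \<Longrightarrow> ((\<lambda>w. g w r) has_real_derivative g' u r) (at u)" "R > 0"
    and "\<And>u r. r > 0 \<Longrightarrow> g' u r \<le> 1 / (4 * r\<^sup>2)" "c \<ge> 1 / 2" "v \<le> w"
  shows "rescaled_force c A R g v s \<le> rescaled_force c A R g w s"
proof (rule DERIV_nonneg_imp_nondecreasing[OF \<open>v \<le> w\<close>])
  fix x
  let ?r = "R * exp (- s)"
  have "?r > 0" using \<open>R > 0\<close> by simp
  have "?r\<^sup>2 * g' (A + exp (c * s) * x) ?r \<le> ?r\<^sup>2 * (1 / (4 * ?r\<^sup>2))"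
    by (rule mult_left_mono[OF assms(3)[OF \<open>?r > 0\<close>]]) simp
  also have "\<dots> = 1 / 4" using \<open>R > 0\<close> by simp
  also have "\<dots> \<le> c\<^sup>2" using power_mono[OF \<open>c \<ge> 1 / 2\<close>, of 2] by (simp add: power2_eq_square)
  finally show "\<exists>y. ((\<lambda>v. rescaled_force c A R g v s) has_real_derivative y) (at x) \<and> 0 \<le> y"
    using rescaled_force_has_derivative[where g = g and g' = g', OF assms(1,2)] by (metis diff_ge_0_iff_ge)
qed

text \<open>For |s| <= S the radius is at most R exp S, so a bound on g' bounds the slope uniformly
  in v.\<close>

lemma rescaled_force_lipschitz:
  assumes "\<And>u r. r > 0 \<Longrightarrow> ((\<lambda>w. g w r) has_real_derivative g' u r) (at u)" "R > 0"
    and M: "\<And>u r. r > 0 \<Longrightarrow> \<bar>g' u r\<bar> \<le> M"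
  shows "\<exists>K. \<forall>s v w. \<bar>s\<bar> \<le> S \<longrightarrow> \<bar>rescaled_force c A R g v s - rescaled_force c A R g w s\<bar> \<le> K * \<bar>v - w\<bar>"
proof (intro exI allI impI)
  fix s v w :: real assume s: "\<bar>s\<bar> \<le> S"
  let ?r = "R * exp (- s)"
  have "?r > 0" using \<open>R > 0\<close> by simp
  have "norm (rescaled_force c A R g v s - rescaled_force c A R g w s) \<le> (c\<^sup>2 + (R * exp S)\<^sup>2 * M) * norm (v - w)"
  proof (rule field_differentiable_bound[OF convex_UNIV])
    fix x
    show "((\<lambda>v. rescaled_force c A R g v s) has_field_derivative c\<^sup>2 - ?r\<^sup>2 * g' (A + exp (c * s) * x) ?r) (at x within UNIV)"
      using rescaled_force_has_derivative[where g = g and g' = g', OF assms(1,2)] by simp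
    have "M \<ge> 0" using M[of 1] abs_ge_zero order_trans zero_less_one by blast
    have "\<bar>?r\<^sup>2 * g' (A + exp (c * s) * x) ?r\<bar> \<le> (R * exp S)\<^sup>2 * M"
      unfolding abs_mult
      by (intro mult_mono M) (use \<open>R > 0\<close> s in \<open>auto intro!: power_mono\<close>)
    then show "norm (c\<^sup>2 - ?r\<^sup>2 * g' (A + exp (c * s) * x) ?r) \<le> c\<^sup>2 + (R * exp S)\<^sup>2 * M"
      by (simp add: abs_le_iff) (smt (verit) zero_le_power2)
  qed auto
  then show "\<bar>rescaled_force c A R g v s - rescaled_force c A R g w s\<bar> \<le> (c\<^sup>2 + (R * exp S)\<^sup>2 * M) * \<bar>v - w\<bar>"
    by simp
qed

section \<open>Inversion of the family and foliation charts\<close>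

lemma has_real_derivative_fst_slice:
  assumes "(F has_derivative D) (at (u, x))"
  shows "((\<lambda>w. F (w, x)) has_real_derivative D (1, 0)) (at u)"
proof -
  interpret D: bounded_linear D using assms by (rule has_derivative_bounded_linear)
  have "((\<lambda>w. F (w, x)) has_derivative (\<lambda>t. D (t, 0))) (at u)"
    by (rule has_derivative_compose[where f = "\<lambda>w. (w, x)" and g = F, OF _ assms])
      (auto intro!: derivative_eq_intros)
  moreover have "(\<lambda>t. D (t, 0)) = (*) (D (1, 0))"
  proof
    fix t show "D (t, 0) = D (1, 0) * t" using D.scaleR[of t "(1, 0)"] by simp
  qed
  ultimately show ?thesis by (simp only: has_field_derivative_def)
qed

text \<open>The linear lower bound on gaps yields three things: injectivity, surjectivity through
  growth at both ends, and a derivative in \<beta> of at least \<open>m s\<close>.\<close>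

lemma parametric_increasing_inverse:
  fixes v :: "real \<Rightarrow> real \<Rightarrow> real"
  assumes Ck: "\<And>k. Ck_on k UNIV (\<lambda>p. v (fst p) (snd p))"
    and m: "\<And>s. m s > 0"
    and gap: "\<And>\<beta>1 \<beta>2 s. \<beta>1 \<le> \<beta>2 \<Longrightarrow> m s * (\<beta>2 - \<beta>1) \<le> v \<beta>2 s - v \<beta>1 s"
  obtains a where "\<And>\<beta> s. a (v \<beta> s, s) = \<beta>" "\<And>w s. v (a (w, s)) s = w" "\<And>k. Ck_on k UNIV a"
proof -
  let ?v = "\<lambda>p. v (fst p) (snd p)"
  have D: "(?v has_derivative frechet_derivative ?v (at p)) (at p)" for p
    using Ck_on_Suc_imp_has_derivative[OF Ck] by simp
  have Dv: "((\<lambda>\<beta>. v \<beta> s) has_real_derivative frechet_derivative ?v (at (\<beta>, s)) (1, 0)) (at \<beta>)" for \<beta> s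
    using has_real_derivative_fst_slice[OF D[of "(\<beta>, s)"]] by simp
  have less: "v \<beta>1 s < v \<beta>2 s" if "\<beta>1 < \<beta>2" for \<beta>1 \<beta>2 s
    using gap[of \<beta>1 \<beta>2 s] mult_pos_pos[OF m[of s], of "\<beta>2 - \<beta>1"] that by simp
  have inj: "\<beta>1 = \<beta>2" if "v \<beta>1 s = v \<beta>2 s" for \<beta>1 \<beta>2 s
    using less[of \<beta>1 \<beta>2 s] less[of \<beta>2 \<beta>1 s] that by linarith
  have surj: "\<exists>\<beta>. v \<beta> s = w" for s w
  proof -
    \<comment> \<open>The gap over a length B is at least the distance from w to v 0 s, which places
      w between v (- B) s and v B s.\<close>
    define B where "B = \<bar>w - v 0 s\<bar> / m s"
    have "B \<ge> 0" "m s * B = \<bar>w - v 0 s\<bar>" using m[of s] by (auto simp: B_def)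
    then have "v (- B) s \<le> w" "w \<le> v B s" using gap[of 0 B s] gap[of "- B" 0 s] by auto
    moreover have "continuous_on {- B..B} (\<lambda>\<beta>. v \<beta> s)"
      using Dv by (auto intro!: continuous_at_imp_continuous_on DERIV_isCont)
    ultimately show ?thesis using IVT'[of "\<lambda>\<beta>. v \<beta> s" "- B" w B] \<open>B \<ge> 0\<close> by auto
  qed
  define a where "a p = (THE \<beta>. v \<beta> (snd p) = fst p)" for p
  have left: "a (v \<beta> s, s) = \<beta>" for \<beta> s using inj by (auto simp: a_def)
  have right: "v (a (w, s)) s = w" for w s using surj[of s w] left by force
  have "frechet_derivative ?v (at p) (1, 0) \<noteq> 0" for p
  proof -
    obtain \<beta> s where p: "p = (\<beta>, s)" by (cases p)
    \<comment> \<open>The gap makes this difference nondecreasing in \<beta>, so its derivative is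
      nonnegative.\<close>
    have "((\<lambda>\<beta>. v \<beta> s - m s * \<beta>) has_real_derivative frechet_derivative ?v (at p) (1, 0) - m s) (at \<beta>)"
      unfolding p by (auto intro!: derivative_eq_intros Dv)
    moreover have "mono_on UNIV (\<lambda>\<beta>. v \<beta> s - m s * \<beta>)"
      using gap by (auto intro!: mono_onI simp: algebra_simps)
    ultimately have "frechet_derivative ?v (at p) (1, 0) - m s \<ge> 0"
      by (intro mono_on_imp_deriv_nonneg[of UNIV]) auto
    then show ?thesis using m[of s] by simp
  qed
  then have "Ck_on k UNIV a" for k
    by (rule Ck_on_parametric_inverse[OF Ck]) (simp_all add: left right)
  with left right show thesis by (rule that)
qed

text \<open>The leaves are the level sets of \<open>k\<close>, and sending (u, x) to (k (u, x), x)
  is a diffeomorphism of \<open>M\<close> onto itself whose inverse is built from \<open>h\<close>: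
  one global straightening supplies all charts.\<close>

lemma smooth_foliation_graph_family:
  fixes h k :: "real \<times> 'b::euclidean_space \<Rightarrow> real"
  defines "M \<equiv> {p. snd p \<noteq> 0}"
  assumes h: "\<And>j. Ck_on j M h" and k: "\<And>j. Ck_on j M k"
    and kh: "\<And>\<beta> x. x \<noteq> 0 \<Longrightarrow> k (h (\<beta>, x), x) = \<beta>"
    and hk: "\<And>u x. x \<noteq> 0 \<Longrightarrow> h (k (u, x), x) = u"
  shows "smooth_foliation M (range (\<lambda>\<beta>. {(h (\<beta>, x), x) | x. x \<noteq> 0}))"
proof -
  define L where "L \<beta> = {(h (\<beta>, x), x) | x. x \<noteq> 0}" for \<beta>
  define \<Phi> where "\<Phi> p = (k p, snd p)" for p
  define \<Psi> where "\<Psi> q = (h q, snd q)" for q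
  have "open M"
    unfolding M_def by (intro open_Collect_neq continuous_intros)
  have L_iff: "p \<in> L \<beta> \<longleftrightarrow> p \<in> M \<and> k p = \<beta>" for p \<beta>
    by (cases p) (auto simp: L_def M_def kh hk intro!: exI[of _ "snd p"])
  have \<Psi>\<Phi>: "\<Psi> (\<Phi> p) = p" "\<Phi> p \<in> M" if "p \<in> M" for p
    using that by (cases p; auto simp: \<Psi>_def \<Phi>_def M_def hk)+
  have \<Phi>\<Psi>: "\<Phi> (\<Psi> q) = q" "\<Psi> q \<in> M" if "q \<in> M" for q
    using that by (cases q; auto simp: \<Psi>_def \<Phi>_def M_def kh)+
  have Ck\<Phi>: "Ck_on j M \<Phi>" and Ck\<Psi>: "Ck_on j M \<Psi>" for j
    unfolding \<Phi>_def \<Psi>_def by (intro Ck_on_Pair Ck_on_snd Ck_on_id h k \<open>open M\<close>)+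
  have "smooth_foliation M (range L)"
    unfolding smooth_foliation_def
  proof (intro conjI ballI)
    show "open M" by fact
    show "\<Union> (range L) = M" by (auto simp: L_iff)
    show "disjoint (range L)" by (auto simp: disjoint_def L_iff)
    fix N assume "N \<in> range L"
    then obtain \<beta> where N: "N = L \<beta>" by blast
    obtain e :: 'b where "e \<in> Basis" using nonempty_Basis by blast
    then have "(h (\<beta>, e), e) \<in> L \<beta>" using nonzero_Basis by (auto simp: L_def)
    then show "N \<noteq> {}" "N \<subseteq> M" by (auto simp: N L_iff)
  next
    fix p assume p: "p \<in> M"
    \<comment> \<open>A chart must have convex image and \<open>M\<close> is not convex, so the
      straightening is restricted to the preimage of a ball.\<close>
    obtain e where e: "e > 0" "ball (\<Phi> p) e \<subseteq> M" using \<Psi>\<Phi>(2)[OF p] \<open>open M\<close> by (meson openE)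
    define W where "W = ball (\<Phi> p) e"
    define U where "U = M \<inter> \<Phi> -` W"
    have "open U"
      unfolding U_def Int_commute[of M]
      by (rule continuous_open_preimage[OF Ck_on_imp_continuous_on[OF Ck\<Phi>] \<open>open M\<close>, unfolded Int_commute[of M]])
        (simp add: W_def)
    have WM: "W \<subseteq> M" using e by (simp add: W_def)
    have \<Psi>W: "\<Psi> y \<in> U" if "y \<in> W" for y 
    proof -
      have "y \<in> M" using that WM by blast
      from \<Phi>\<Psi>[OF this] show ?thesis using that by (simp add: U_def)
    qed
    have im: "\<Phi> ` U = W"
    proof
      show "W \<subseteq> \<Phi> ` U" using \<Psi>W \<Phi>\<Psi>(1) WM by (force simp: image_iff)
    qed (auto simp: U_def)
    have plaque: "y' \<in> \<Phi> ` (N \<inter> U)"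
      if N: "N \<in> range L" and y: "y \<in> \<Phi> ` (N \<inter> U)" and y': "y' \<in> W" "y' \<bullet> (1, 0) = y \<bullet> (1, 0)" for N y y'
    proof -
      obtain \<beta> where \<beta>: "N = L \<beta>" using N by blast
      have "fst y' = \<beta>" using y y'(2) unfolding \<beta> by (auto simp: L_iff \<Phi>_def inner_prod_def)
      moreover have "k (\<Psi> y') = fst y'" using \<Phi>\<Psi>(1)[of y'] y' WM by (auto simp: \<Phi>_def prod_eq_iff)
      ultimately have "\<Psi> y' \<in> N \<inter> U" using \<Psi>W[OF y'(1)] by (auto simp: \<beta> L_iff U_def)
      moreover have "\<Phi> (\<Psi> y') = y'" using \<Phi>\<Psi>(1) y' WM by blast
      ultimately show ?thesis by (metis imageI)
    qed
    have smooth: "smooth_on U \<Phi>" "smooth_on W \<Psi>"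
      using \<open>open U\<close> WM Ck\<Phi> Ck\<Psi> unfolding smooth_on_iff_Ck_on
      by (auto intro: Ck_on_subset simp: U_def W_def)
    show "\<exists>U W (\<phi> :: real \<times> 'b \<Rightarrow> real \<times> 'b) \<psi> b. open U \<and> p \<in> U \<and> U \<subseteq> M \<and> open W \<and> convex W \<and> \<phi> ` U = W \<and>
        (\<forall>x\<in>U. \<psi> (\<phi> x) = x) \<and> (\<forall>y\<in>W. \<phi> (\<psi> y) = y) \<and>
        smooth_on U \<phi> \<and> smooth_on W \<psi> \<and> b \<in> Basis \<and>
        (\<forall>N\<in>range L. \<forall>y\<in>\<phi> ` (N \<inter> U). \<forall>y'\<in>W. y' \<bullet> b = y \<bullet> b \<longrightarrow> y' \<in> \<phi> ` (N \<inter> U))"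
    proof (rule exI[of _ U], rule exI[of _ W], rule exI[of _ \<Phi>], rule exI[of _ \<Psi>], rule exI[of _ "(1, 0)"],
        intro conjI ballI impI)
      show "p \<in> U" using p e by (simp add: U_def W_def)
      show "\<Psi> (\<Phi> x) = x" if "x \<in> U" for x using that \<Psi>\<Phi>(1) by (simp add: U_def)
      show "\<Phi> (\<Psi> y) = y" if "y \<in> W" for y using that \<Phi>\<Psi>(1) WM by blast
      show "y' \<in> \<Phi> ` (N \<inter> U)" if "N \<in> range L" "y \<in> \<Phi> ` (N \<inter> U)" "y' \<in> W" "y' \<bullet> (1, 0) = y \<bullet> (1, 0)" for N y y'
        using plaque that by blast
    qed (use \<open>open U\<close> im smooth in \<open>simp_all add: U_def W_def Basis_prod_def\<close>)
  qed
  then show ?thesis unfolding L_def .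
qed

text \<open>Elements of \<open>N_set\<close> are total functions on the reals constrained only for r
  > 0, so distinct means distinct at some r > 0; \<open>radial_graph\<close> likewise reads only
  positive radii.\<close>

theorem theorem3:
  fixes V :: "real \<Rightarrow> real \<Rightarrow> real" and A :: real
  assumes dim: "CARD('n::finite) \<ge> 3"
    and smooth: "smooth_on (UNIV :: (real \<times> (real ^ 'n)) set) (\<lambda>p. V (fst p) (norm (snd p)))"
    and compact_supp: "compact (closure {p :: real \<times> (real ^ 'n). V (fst p) (norm (snd p)) \<noteq> 0})"
    and second_deriv: "\<And>u r. r > 0 \<Longrightarrow> deriv (\<lambda>w. deriv (\<lambda>v. V v r) w) u \<le> 1 / (4 * r\<^sup>2)"
  shows "(\<forall>u1\<in>N_set CARD('n) V A. \<forall>u2\<in>N_set CARD('n) V A. (\<exists>r>0. u1 r \<noteq> u2 r) \<longrightarrow>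
            (\<forall>r>0. u1 r < u2 r) \<or> (\<forall>r>0. u1 r > u2 r))
         \<and> smooth_foliation {p :: real \<times> (real ^ 'n). snd p \<noteq> 0}
             (radial_graph ` N_set CARD('n) V A)"
proof -
  define n where "n = CARD('n)"
  define c where "c = (real n - 2) / 2"
  have n: "n \<ge> 3" "real n = 2 * c + 2" and c: "c \<ge> 1 / 2" using dim by (auto simp: n_def c_def field_simps)
  \<comment> \<open>\<open>F\<close>, \<open>P\<close> and \<open>Q\<close> represent V, V_u and
    V_uu as functions of (u, x), since smoothness is given in x and not in r.\<close>
  define F where "F = (\<lambda>p :: real \<times> (real ^ 'n). V (fst p) (norm (snd p)))"
  define P where "P = (\<lambda>p. frechet_derivative F (at p) (1, 0))"
  define Q where "Q = (\<lambda>p. frechet_derivative P (at p) (1, 0))"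
  \<comment> \<open>A fixed unit vector: the radial variable is recovered along the ray r e, on
    which \<open>P\<close> depends smoothly on r.\<close>
  define e where "e = (axis undefined 1 :: real ^ 'n)"
  have [simp]: "norm e = 1" by (simp add: e_def norm_axis_1)
  have b10: "(1, 0) \<in> (Basis :: (real \<times> (real ^ 'n)) set)" by (simp add: Basis_prod_def)
  have CkF: "Ck_on k UNIV F" for k using smooth unfolding smooth_on_iff_Ck_on F_def by blast
  have CkP: "Ck_on k UNIV P" for k using CkF[of "Suc k"] b10 by (simp add: P_def)
  have CkQ: "Ck_on k UNIV Q" for k using CkP[of "Suc k"] b10 by (simp add: Q_def)
  have F': "((\<lambda>w. F (w, x)) has_real_derivative P (u, x)) (at u)" for u x
    unfolding P_def by (rule has_real_derivative_fst_slice) (rule Ck_on_Suc_imp_has_derivative[OF CkF], simp)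
  have P': "((\<lambda>w. P (w, x)) has_real_derivative Q (u, x)) (at u)" for u x
    unfolding Q_def by (rule has_real_derivative_fst_slice) (rule Ck_on_Suc_imp_has_derivative[OF CkP], simp)
  have VP: "deriv (\<lambda>w. V w r) u = P (u, r *\<^sub>R e)" if "r > 0" for u r
    using F'[of "r *\<^sub>R e" u] that by (intro DERIV_imp_deriv) (simp add: F_def)
  have VQ: "Q (u, r *\<^sub>R e) \<le> 1 / (4 * r\<^sup>2)" if "r > 0" for u r
    using second_deriv[OF that, of u] DERIV_imp_deriv[OF P'[of "r *\<^sub>R e" u]] by (simp add: VP[OF that])
  have "bounded {p. F p \<noteq> 0}"
    using compact_supp compact_imp_bounded bounded_subset closure_subset unfolding F_def by blast
  then obtain B where B: "B > 0" "\<And>p. F p \<noteq> 0 \<Longrightarrow> norm p \<le> B" unfolding bounded_pos by blast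
  have far: "open {p :: real \<times> (real ^ 'n). norm p > B}"
    by (intro open_Collect_less continuous_intros)
  \<comment> \<open>On the open exterior of the ball \<open>F\<close> agrees with 0, hence so do its
    derivatives.\<close>
  have P0: "P p = 0" if "norm p > B" for p
    using frechet_derivative_cong_open[OF far, of p F "\<lambda>p. 0"] B that by (force simp: P_def)
  have Q0: "Q p = 0" if "norm p > B" for p
    using frechet_derivative_cong_open[OF far, of p P "\<lambda>p. 0"] P0 that by (force simp: Q_def)
  have "bounded (Q ` cball 0 B)"
    by (intro compact_imp_bounded compact_continuous_image continuous_on_subset[OF Ck_on_imp_continuous_on[OF CkQ]]) auto
  then obtain K where K: "K > 0" "\<And>p. norm p \<le> B \<Longrightarrow> \<bar>Q p\<bar> \<le> K" unfolding bounded_pos by auto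
  have QK: "\<bar>Q p\<bar> \<le> K" for p using K Q0 by (cases "norm p \<le> B") auto
  \<comment> \<open>\<open>P\<close> is known to vanish where the norm strictly exceeds
    \<open>B\<close>, and s = 0 corresponds to r = R; the 1 supplies the strictness.\<close>
  define R where "R = B + 1"
  have "R > 0" using B by (simp add: R_def)
  define G where "G = rescaled_force c A R (\<lambda>u r. P (u, r *\<^sub>R e))"
  have GV: "rescaled_force c A R (\<lambda>u r. deriv (\<lambda>w. V w r) u) = G"
    using \<open>R > 0\<close> by (simp add: G_def rescaled_force_def fun_eq_iff VP)
  have lip: "\<exists>K. \<forall>s v w. \<bar>s\<bar> \<le> S \<longrightarrow> \<bar>G v s - G w s\<bar> \<le> K * \<bar>v - w\<bar>" for S
    unfolding G_def by (rule rescaled_force_lipschitz[where g' = "\<lambda>u r. Q (u, r *\<^sub>R e)"]) (auto intro: P' QK \<open>R > 0\<close>)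
  have mono: "mono (\<lambda>v. G v s)" for s
    unfolding G_def by (rule monoI, rule rescaled_force_mono[where g' = "\<lambda>u r. Q (u, r *\<^sub>R e)"]) (use c \<open>R > 0\<close> in \<open>auto intro: P' VQ\<close>)
  have lin: "\<forall>s\<le>0. \<forall>v. G v s = c\<^sup>2 * v"
  proof (intro allI impI)
    fix s v :: real assume "s \<le> 0"
    have "R * 1 \<le> R * exp (- s)" using \<open>s \<le> 0\<close> \<open>R > 0\<close> by (intro mult_left_mono) auto
    also have "\<dots> = norm ((R * exp (- s)) *\<^sub>R e)" using \<open>R > 0\<close> by simp
    also have "\<dots> \<le> norm (A + exp (c * s) * v, (R * exp (- s)) *\<^sub>R e)" by (rule norm_snd_le)
    finally show "G v s = c\<^sup>2 * v" using P0 by (simp add: G_def rescaled_force_def R_def)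
  qed
  have CkG: "Ck_on k UNIV (\<lambda>p. G (fst p) (snd p))" for k
    unfolding G_def by (rule Ck_on_rescaled_force[OF CkP])
  have "c \<ge> 0" using c by simp
  from monotone_second_order_family[of G c, OF CkG lip mono lin \<open>c \<ge> 0\<close>]
  obtain v v1 where family: "\<forall>\<beta> s. (v \<beta> has_real_derivative v1 \<beta> s) (at s)"
    "\<forall>\<beta> s. (v1 \<beta> has_real_derivative G (v \<beta> s) s) (at s)"
    "\<forall>\<beta> s. s \<le> 0 \<longrightarrow> v \<beta> s = \<beta> * exp (c * s)"
    "\<forall>k. Ck_on k UNIV (\<lambda>p. v (fst p) (snd p))"
    "\<forall>\<beta>1 \<beta>2 s. \<beta>1 \<le> \<beta>2 \<longrightarrow> min 1 (exp (c * s)) * (\<beta>2 - \<beta>1) \<le> v \<beta>2 s - v \<beta>1 s"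
    by (elim exE conjE)
  note v = family(1)[rule_format] and v1 = family(2)[rule_format] and nonpos = family(3)[rule_format]
    and Ckv = family(4)[rule_format] and gap = family(5)[rule_format]
  have N_iff: "u \<in> N_set n V A \<longleftrightarrow> (\<exists>\<beta>. \<forall>r>0. u r = A + exp (c * (ln R - ln r)) * v \<beta> (ln R - ln r))" for u
    by (rule N_set_iff_family[where v = v and ?v1.0 = v1 and A = A and V = V, OF _ n(2) \<open>R > 0\<close>, unfolded GV])
      ((rule lip v v1 nonpos | use n in simp); assumption?)+
  have less: "v \<beta>1 s < v \<beta>2 s" if "\<beta>1 < \<beta>2" for \<beta>1 \<beta>2 s
  proof -
    have "0 < min 1 (exp (c * s)) * (\<beta>2 - \<beta>1)" using that by simp
    also have "\<dots> \<le> v \<beta>2 s - v \<beta>1 s" using that by (intro gap) simp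
    finally show ?thesis by simp
  qed
  have order: "(\<forall>r>0. u1 r < u2 r) \<or> (\<forall>r>0. u1 r > u2 r)"
    if mem: "u1 \<in> N_set n V A" "u2 \<in> N_set n V A" and ne: "\<exists>r>0. u1 r \<noteq> u2 r" for u1 u2
  proof -
    obtain \<beta>1 \<beta>2 where \<beta>: "\<And>r. r > 0 \<Longrightarrow> u1 r = A + exp (c * (ln R - ln r)) * v \<beta>1 (ln R - ln r)"
        "\<And>r. r > 0 \<Longrightarrow> u2 r = A + exp (c * (ln R - ln r)) * v \<beta>2 (ln R - ln r)"
      using mem unfolding N_iff by blast
    have "\<beta>1 \<noteq> \<beta>2" using ne \<beta> by auto
    then consider "\<beta>1 < \<beta>2" | "\<beta>2 < \<beta>1" by linarith
    then show ?thesis by cases (simp_all add: \<beta> less)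
  qed
  obtain a where left: "\<And>\<beta> s. a (v \<beta> s, s) = \<beta>" and right: "\<And>w s. v (a (w, s)) s = w"
    and Cka: "\<And>k. Ck_on k UNIV a"
    by (rule parametric_increasing_inverse[OF Ckv _ gap]) auto
  let ?M = "{p :: real \<times> (real ^ 'n). snd p \<noteq> 0}"
  define \<sigma> where "\<sigma> p = ln R - ln (norm (snd p))" for p :: "real \<times> (real ^ 'n)"
  have "open ?M" by (intro open_Collect_neq continuous_intros)
  \<comment> \<open>ln |x| is rewritten as half of ln of the inner product of x with itself, to
    which the bilinear and logarithm rules apply.\<close>
  have Ck\<sigma>: "Ck_on k ?M \<sigma>" for k
  proof -
    have "Ck_on k ?M (\<lambda>p. ln R - (1 / 2) * ln (snd p \<bullet> snd p))"
      by (intro Ck_on_diff Ck_on_mult Ck_on_ln Ck_on_const Ck_on_inner Ck_on_snd Ck_on_id \<open>open ?M\<close>) auto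
    also have "Ck_on k ?M (\<lambda>p. ln R - (1 / 2) * ln (snd p \<bullet> snd p)) \<longleftrightarrow> Ck_on k ?M \<sigma>"
      by (rule Ck_on_cong[OF \<open>open ?M\<close>]) (simp add: \<sigma>_def dot_square_norm ln_realpow)
    finally show ?thesis .
  qed
  \<comment> \<open>\<open>h\<close> is the value at x of the solution with parameter \<beta>;
    \<open>k\<close> is the parameter of the solution through a given point.\<close>
  define h where "h p = A + exp (c * \<sigma> p) * v (fst p) (\<sigma> p)" for p
  define k where "k p = a (exp (- c * \<sigma> p) * (fst p - A), \<sigma> p)" for p
  have "smooth_foliation ?M (range (\<lambda>\<beta>. {(h (\<beta>, x), x) | x. x \<noteq> 0}))"
  proof (rule smooth_foliation_graph_family)
    show "Ck_on j ?M h" for j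
      unfolding h_def
      by (intro Ck_on_add Ck_on_mult Ck_on_exp Ck_on_const Ck\<sigma> \<open>open ?M\<close>
          Ck_on_compose[OF \<open>open ?M\<close> open_UNIV Ckv, where f = "\<lambda>p. (fst p, \<sigma> p)", simplified] Ck_on_Pair Ck_on_fst Ck_on_id)
    show "Ck_on j ?M k" for j
      unfolding k_def
      by (rule Ck_on_compose[OF \<open>open ?M\<close> open_UNIV Cka _ subset_UNIV])
        (intro Ck_on_Pair Ck_on_mult Ck_on_exp Ck_on_diff Ck_on_const Ck\<sigma> Ck_on_fst Ck_on_id \<open>open ?M\<close>)
    have cancel: "exp (- c * s) * (exp (c * s) * w) = w" "exp (c * s) * (exp (- c * s) * w) = w" for s w
      by (simp_all add: exp_minus field_simps)
    have \<sigma>_Pair: "\<sigma> (u, x) = ln R - ln (norm x)" for u x by (simp add: \<sigma>_def)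
    show "k (h (\<beta>, x), x) = \<beta>" for \<beta> x
      unfolding k_def h_def \<sigma>_Pair fst_conv add_diff_cancel_left' cancel by (rule left)
    show "h (k (u, x), x) = u" for u x
      unfolding k_def h_def \<sigma>_Pair fst_conv right cancel by simp
  qed
  moreover have "range (\<lambda>\<beta>. {(h (\<beta>, x), x) | x. x \<noteq> 0}) = radial_graph ` N_set n V A"
  proof -
    \<comment> \<open>A representative for each \<beta>; any other member with the same \<beta>
      differs from it at most for r <= 0 and has the same graph.\<close>
    define f where "f \<beta> r = A + exp (c * (ln R - ln r)) * v \<beta> (ln R - ln r)" for \<beta> r
    have graph: "radial_graph u = {(h (\<beta>, x), x) | x. x \<noteq> 0}" if "\<forall>r>0. u r = f \<beta> r" for u \<beta>
      using that by (fastforce simp: radial_graph_def h_def f_def \<sigma>_def)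
    have mem: "f \<beta> \<in> N_set n V A" for \<beta> unfolding N_iff f_def by blast
    show ?thesis
    proof (intro equalityI image_subsetI)
      fix \<beta> :: real
      show "{(h (\<beta>, x), x) | x. x \<noteq> 0} \<in> radial_graph ` N_set n V A"
        using graph[of "f \<beta>" \<beta>] mem by (intro image_eqI[of _ _ "f \<beta>"]) simp_all
    next
      fix u assume "u \<in> N_set n V A"
      then obtain \<beta> where "\<forall>r>0. u r = f \<beta> r" unfolding N_iff f_def by blast
      then show "radial_graph u \<in> range (\<lambda>\<beta>. {(h (\<beta>, x), x) | x. x \<noteq> 0})"
        using graph by (intro image_eqI[of _ _ \<beta>]) simp_all
    qed
  qed
  ultimately show ?thesis using order unfolding n_def by simp
qed

end
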